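(* Let $S\subset H$ be a generic subspace, let $v^j,v^k$ be two linearly independent principal standard vectors of $S$, and let $\gamma_{j,k}:[0,\frac{\pi}{2}]\to m_S$ be the curve $$\gamma_{j,k}(t)=|v^{j\to k}(t)|^2=\big(|v_1^{j\to k}(t)|^2,|v_2^{j\to k}(t)|^2,\dots\big).$$ Then: (1) The curve $t\mapsto\big(|v_j^{j\to k}(t)|,|v_k^{j\to k}(t)|\big)$, $t\in[0,\frac\pi2]$, is part of an ellipse in $\mathbb{R}^2$ centered at the origin. (2) If $v^j$ and $v^k$ are orthogonal, then $\big(|v_j^{j\to k}(t)|^2,|v_k^{j\to k}(t)|^2\big)$ parametrizes a segment that is contained in the boundary of the projection of $m_S$ onto the plane spanned by $e_j$ and $e_k$. (3) If $v^j$ and $v^k$ are not orthogonal, then for every $t\in[0,\frac\pi2]$ the point $\big(|v_j^{j\to k}(t)|^2,|v_k^{j\to k}(t)|^2\big)$ is an extreme point of the set $\{(x_j,x_k):x\in m_S\}$ and $\gamma_{j,k}(t)$ is an extreme point of $m_S$.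
   Context: $H$ is a complex separable infinite dimensional Hilbert space (inner product linear in the first variable) with a fixed orthonormal basis $E=\{e_j\}_{j=1}^\infty$; for $x\in H$, $x_j=\langle x,e_j\rangle$. Subspaces are closed and $P_S$ is the orthogonal projection onto $S$. $\mathcal{D}_S=\{Y \text{ trace class on } H:P_SY=Y\ge0,\ \operatorname{tr}(Y)=1\}$, and $m_S=\{(\langle Ye_n,e_n\rangle)_{n\in\mathbb{N}}:Y\in\mathcal{D}_S\}\subset\ell^1(\mathbb{R})$. $S$ is generic (with respect to $E$) if there exists $x\in S$ with $\langle x,e_j\rangle\ne0$ for every $j\in\mathbb{N}$ (equivalently $P_Se_j\neq0$ for all $j$). For generic $S$ the principal standard vectors are $v^j=P_Se_j/\|P_Se_j\|$, $j\in\mathbb{N}$; $v^j_k=\langle v^j,e_k\rangle$ is the $k$-th coordinate of $v^j$. For linearly independent $v^j,v^k$, $$v^{j\to k}(t)=\cos(t)\,v^j+\sin(t)\,e^{i\arg(v^j_k)}\,\frac{v^k-\langle v^k,v^j\rangle v^j}{\|v^k-\langle v^k,v^j\rangle v^j\|},$$ with the convention $\arg(0)=0$, and $v_n^{j\to k}(t)$ denotes its $n$-th coordinate in the basis $E$. *)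

theory Defs
  imports "HOL-Analysis.Analysis" "HOL-Library.Function_Algebras"
begin

section \<open>Complex Hilbert spaces\<close>

text \<open>The inner product is linear in the first variable.\<close>

class complex_hilbert = banach +
  fixes scaleC :: "complex \<Rightarrow> 'a \<Rightarrow> 'a"  (infixr \<open>*\<^sub>C\<close> 75)
    and cinner :: "'a \<Rightarrow> 'a \<Rightarrow> complex"
  assumes scaleC_of_real: "scaleC (complex_of_real r) x = scaleR r x"
    and scaleC_add_right: "scaleC a (x + y) = scaleC a x + scaleC a y"
    and scaleC_add_left: "scaleC (a + b) x = scaleC a x + scaleC b x"
    and scaleC_scaleC: "scaleC a (scaleC b x) = scaleC (a * b) x"
    and cinner_add_left: "cinner (x + y) z = cinner x z + cinner y z"
    and cinner_scaleC_left: "cinner (scaleC a x) y = a * cinner x y"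
    and cinner_commute: "cinner x y = cnj (cinner y x)"
    and cinner_self: "cinner x x = complex_of_real ((norm x)\<^sup>2)"

global_interpretation complex_vector:
  vector_space "scaleC :: complex \<Rightarrow> 'a \<Rightarrow> 'a::complex_hilbert"
  defines csubspace = complex_vector.subspace
    and cdependent = complex_vector.dependent
    and cspan = complex_vector.span
proof
  show "1 *\<^sub>C x = x" for x :: 'a
    using scaleC_of_real[of 1 x] by simp
qed (simp_all add: scaleC_add_right scaleC_add_left scaleC_scaleC)

text \<open>An orthonormal basis indexed by the natural numbers; its existence makes the
  space separable and infinite dimensional.\<close>

definition orthonormal_basis :: "(nat \<Rightarrow> 'a::complex_hilbert) \<Rightarrow> bool" where
  "orthonormal_basis e \<longleftrightarrow>
     (\<forall>m n. cinner (e m) (e n) = (if m = n then 1 else 0)) \<and>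
     closure (cspan (range e)) = UNIV"

definition closed_csubspace :: "'a::complex_hilbert set \<Rightarrow> bool" where
  "closed_csubspace S \<longleftrightarrow> csubspace S \<and> closed S"

definition proj :: "'a::complex_hilbert set \<Rightarrow> 'a \<Rightarrow> 'a" where
  "proj S x = (THE y. y \<in> S \<and> (\<forall>z\<in>S. cinner (x - y) z = 0))"

section \<open>Trace class operators\<close>

definition bounded_op :: "('a::complex_hilbert \<Rightarrow> 'a) \<Rightarrow> bool" where
  "bounded_op T \<longleftrightarrow> bounded_linear T \<and> (\<forall>c x. T (c *\<^sub>C x) = c *\<^sub>C T x)"

definition positive_op :: "('a::complex_hilbert \<Rightarrow> 'a) \<Rightarrow> bool" where
  "positive_op T \<longleftrightarrow> bounded_op T \<and> (\<forall>x. cinner (T x) x \<in> \<real>\<^sub>\<ge>\<^sub>0)"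

text \<open>\<open>A = |T|\<close>: the operator \<open>A\<close> is positive and \<open>A\<^sup>2 = T\<^sup>* T\<close>, where the latter is written
  as an identity of sesquilinear forms, so that no adjoint operator has to be introduced.\<close>

definition is_abs_op :: "('a::complex_hilbert \<Rightarrow> 'a) \<Rightarrow> ('a \<Rightarrow> 'a) \<Rightarrow> bool" where
  "is_abs_op A T \<longleftrightarrow> positive_op A \<and> (\<forall>x y. cinner (A (A x)) y = cinner (T x) (T y))"

text \<open>Trace class operators and the trace are expressed through a given orthonormal basis;
  as usual, they do not depend on it.\<close>

definition trace_class :: "(nat \<Rightarrow> 'a::complex_hilbert) \<Rightarrow> ('a \<Rightarrow> 'a) \<Rightarrow> bool" where
  "trace_class e T \<longleftrightarrow> bounded_op T \<and>
     (\<exists>A. is_abs_op A T \<and> (\<lambda>n. cinner (A (e n)) (e n)) summable_on UNIV)"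

definition op_trace :: "(nat \<Rightarrow> 'a::complex_hilbert) \<Rightarrow> ('a \<Rightarrow> 'a) \<Rightarrow> complex" where
  "op_trace e T = (\<Sum>\<^sub>\<infinity>n. cinner (T (e n)) (e n))"

section \<open>Densities and moments of a subspace\<close>

definition density_ops :: "(nat \<Rightarrow> 'a::complex_hilbert) \<Rightarrow> 'a set \<Rightarrow> ('a \<Rightarrow> 'a) set" where
  "density_ops e S =
     {Y. trace_class e Y \<and> (\<forall>x. proj S (Y x) = Y x) \<and> positive_op Y \<and> op_trace e Y = 1}"

text \<open>The diagonal entries of a positive operator are real, so \<open>Re\<close> loses nothing. The
  sequences lie in the space of absolutely summable sequences, whose vector space operations
  are the pointwise ones.\<close>

definition moment_set :: "(nat \<Rightarrow> 'a::complex_hilbert) \<Rightarrow> 'a set \<Rightarrow> (nat \<Rightarrow> real) set" where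
  "moment_set e S = (\<lambda>Y n. Re (cinner (Y (e n)) (e n))) ` density_ops e S"

text \<open>The pointwise real vector space structure on functions, needed for extreme points of
  sets of sequences.\<close>

instantiation "fun" :: (type, real_vector) real_vector
begin

definition scaleR_fun :: "real \<Rightarrow> ('a \<Rightarrow> 'b) \<Rightarrow> 'a \<Rightarrow> 'b" where
  "scaleR_fun r f = (\<lambda>x. r *\<^sub>R f x)"

instance
  by standard (simp_all add: scaleR_fun_def fun_eq_iff scaleR_add_right scaleR_add_left)

end

section \<open>Principal standard vectors and the curves joining them\<close>

definition generic :: "(nat \<Rightarrow> 'a::complex_hilbert) \<Rightarrow> 'a set \<Rightarrow> bool" where
  "generic e S \<longleftrightarrow> (\<exists>x\<in>S. \<forall>j. cinner x (e j) \<noteq> 0)"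

definition principal_vec :: "(nat \<Rightarrow> 'a::complex_hilbert) \<Rightarrow> 'a set \<Rightarrow> nat \<Rightarrow> 'a" where
  "principal_vec e S j = proj S (e j) /\<^sub>R norm (proj S (e j))"

definition curve_vec ::
    "(nat \<Rightarrow> 'a::complex_hilbert) \<Rightarrow> 'a set \<Rightarrow> nat \<Rightarrow> nat \<Rightarrow> real \<Rightarrow> 'a" where
  "curve_vec e S j k t =
     (let v = principal_vec e S j;
          u = principal_vec e S k;
          w = u - cinner u v *\<^sub>C v
      in cos t *\<^sub>R v
         + (complex_of_real (sin t) * exp (\<i> * complex_of_real (Arg (cinner v (e k)))))
             *\<^sub>C (w /\<^sub>R norm w))"

definition curve_coord ::
    "(nat \<Rightarrow> 'a::complex_hilbert) \<Rightarrow> 'a set \<Rightarrow> nat \<Rightarrow> nat \<Rightarrow> nat \<Rightarrow> real \<Rightarrow> complex" where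
  "curve_coord e S j k n t = cinner (curve_vec e S j k t) (e n)"

definition moment_curve ::
    "(nat \<Rightarrow> 'a::complex_hilbert) \<Rightarrow> 'a set \<Rightarrow> nat \<Rightarrow> nat \<Rightarrow> real \<Rightarrow> nat \<Rightarrow> real" where
  "moment_curve e S j k t = (\<lambda>n. (cmod (curve_coord e S j k n t))\<^sup>2)"

section \<open>Centered ellipses\<close>

text \<open>The level set of a positive definite quadratic form: a nondegenerate ellipse centered
  at the origin.\<close>

definition centered_ellipse :: "(real \<times> real) set \<Rightarrow> bool" where
  "centered_ellipse C \<longleftrightarrow>
     (\<exists>a b c. a > 0 \<and> b\<^sup>2 < 4 * a * c \<and> C = {(x, y). a * x\<^sup>2 + b * x * y + c * y\<^sup>2 = 1})"

end

theory Submission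
  imports Defs
begin

text \<open>
  Every \<open>x \<in> S\<close> satisfies \<open>\<langle>x, e\<^sub>j\<rangle> = \<langle>x, P e\<^sub>j\<rangle> = A \<langle>x, v\<rangle>\<close> with \<open>v\<close> the \<open>j\<close>-th principal vector and
  \<open>A = \<parallel>P e\<^sub>j\<parallel>\<close>, and likewise \<open>\<langle>x, e\<^sub>k\<rangle> = B \<langle>x, u\<rangle>\<close>. Since \<open>S\<close> is generic, \<open>A\<close> and \<open>B\<close> are positive.
  The phase in the definition of the curve is the one for which a unit multiple of \<open>u\<close> lies on
  the curve itself: the curve is the real great circle \<open>f t = cos t v + sin t z\<close> with
  \<open>\<parallel>z\<parallel> = 1\<close>, \<open>z \<bottom> v\<close>, on which \<open>f 0 = v\<close> and \<open>f \<theta> = \<phi> u\<close>, where \<open>\<bar>\<phi>\<bar> = 1\<close> and \<open>cos \<theta> = \<bar>\<langle>v, u\<rangle>\<bar>\<close>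
  (\<open>curve_vec_eq_great_circle\<close>). Hence the moduli of the two coordinates are
  \<open>A cos t\<close> and \<open>B cos (t - \<theta>)\<close>, a Lissajous parametrization of an ellipse.

  For a density operator \<open>Y\<close> put \<open>Q s = \<langle>Y f s, f s\<rangle>\<close>. The entries \<open>j\<close> and \<open>k\<close> of its diagonal are
  \<open>A\<^sup>2 Q 0\<close> and \<open>B\<^sup>2 Q \<theta>\<close>, and \<open>Q t + Q (t + \<pi>/2) \<le> 1\<close>, because \<open>f t\<close> and \<open>f (t + \<pi>/2)\<close> are
  orthonormal and \<open>Y\<close> has trace \<open>1\<close>. If \<open>\<theta> = \<pi>/2\<close>, this inequality at \<open>t = 0\<close> is a half-plane
  that contains the projected moment set and whose boundary line carries the projected curve.

  If \<open>\<theta> < \<pi>/2\<close>, the linear functional \<open>sin (2 (\<theta> - t)) Q 0 + sin (2 t) Q \<theta>\<close> attains its maximum over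
  all densities at the pure state \<open>f t\<close>, and the deficit at \<open>Y\<close> is at least
  \<open>sin (2 \<theta>) Q (t + \<pi>/2)\<close> (\<open>density_great_circle_support\<close>). So if the point of the curve at \<open>t\<close> is a
  proper convex combination of the points of two densities, both have \<open>Q (t + \<pi>/2) = 0\<close>, then both
  have \<open>Q t = 1\<close> (\<open>density_great_circle_rigid\<close>), and a density whose expectation at a unit vector
  is \<open>1\<close> has the diagonal of the rank one projection onto it (\<open>density_pure_diagonal\<close>). This yields
  extremality in the plane and in the sequence space at once.

  The inequality between the trace along the basis and the expectations at another orthonormal
  family is the operator-theoretic ingredient. It comes from Cholesky elimination of a positive form on finitely many basis vectors
  (\<open>trace_compression_finite\<close>) and passage to the limit.
\<close>

section \<open>Positive sesquilinear forms\<close>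

text \<open>The inner product, the forms \<open>\<langle>Y x, y\<rangle>\<close> of positive operators and the remainders of an
  elimination step are all treated alike.\<close>

locale positive_form =
  fixes B :: "'a::complex_hilbert \<Rightarrow> 'a \<Rightarrow> complex"
  assumes add_left: "B (x + y) z = B x z + B y z"
    and scaleC_left: "B (c *\<^sub>C x) z = c * B x z"
    and hermitian: "B x y = cnj (B y x)"
    and nonneg: "0 \<le> Re (B x x)"
begin

lemma add_right: "B z (x + y) = B z x + B z y"
  by (metis add_left complex_cnj_add hermitian)

lemma scaleC_right: "B z (c *\<^sub>C x) = cnj c * B z x"
  by (metis complex_cnj_mult hermitian scaleC_left)

lemma zero_left: "B 0 z = 0"
  using add_left[of 0 0 z] by simp

lemma minus_left: "B (- x) z = - B x z"
  using add_left[of x "- x" z] by (simp add: zero_left add_eq_0_iff)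

lemma minus_right: "B z (- x) = - B z x"
  by (metis minus_left complex_cnj_minus hermitian)

lemma diff_left: "B (x - y) z = B x z - B y z"
  using add_left[of x "- y" z] by (simp add: minus_left)

lemma diff_right: "B z (x - y) = B z x - B z y"
  using add_right[of z x "- y"] by (simp add: minus_right)

lemma scaleR_left: "B (r *\<^sub>R x) z = complex_of_real r * B x z"
  by (metis scaleC_left scaleC_of_real)

lemma scaleR_right: "B z (r *\<^sub>R x) = complex_of_real r * B z x"
  by (metis scaleC_right scaleC_of_real complex_cnj_complex_of_real)

lemma sum_left: "B (\<Sum>i\<in>I. x i) z = (\<Sum>i\<in>I. B (x i) z)"
  by (induction I rule: infinite_finite_induct) (simp_all add: zero_left add_left)

lemma diag_real: "B x x = complex_of_real (Re (B x x))"
  using hermitian[of x x] by (simp add: complex_eq_iff)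

lemma diag_scaleC: "Re (B (c *\<^sub>C x) (c *\<^sub>C x)) = (cmod c)\<^sup>2 * Re (B x x)"
proof -
  have "B (c *\<^sub>C x) (c *\<^sub>C x) = complex_of_real ((cmod c)\<^sup>2) * B x x"
    by (simp add: scaleC_left scaleC_right complex_norm_square mult_ac del: of_real_power)
  then show ?thesis by simp
qed

lemma diag_add: "Re (B (x + y) (x + y)) = Re (B x x) + 2 * Re (B x y) + Re (B y y)"
  using hermitian[of y x] by (simp add: add_left add_right)

text \<open>The step \<open>s\<close> along \<open>B x y\<close> times \<open>y\<close> turns minimization of the form on a complex line into that of
  a real quadratic polynomial; this serves the Cauchy-Schwarz inequality, the characterization
  of nearest points and the length of the component of one vector orthogonal to another.\<close>

lemma diag_diff_component:
  "Re (B (x - complex_of_real s *\<^sub>C (B x y *\<^sub>C y)) (x - complex_of_real s *\<^sub>C (B x y *\<^sub>C y)))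
     = Re (B x x) - 2 * s * (cmod (B x y))\<^sup>2 + s\<^sup>2 * (cmod (B x y))\<^sup>2 * Re (B y y)"
proof -
  define z where "z = - (complex_of_real s * B x y)"
  have 1: "x - complex_of_real s *\<^sub>C (B x y *\<^sub>C y) = x + z *\<^sub>C y"
    by (simp add: z_def scaleC_scaleC complex_vector.scale_minus_left)
  have "cnj z * B x y = - complex_of_real (s * (cmod (B x y))\<^sup>2)"
    by (simp add: z_def complex_norm_square mult_ac del: of_real_power)
  then have "Re (B x (z *\<^sub>C y)) = - s * (cmod (B x y))\<^sup>2"
    by (simp add: scaleC_right del: of_real_power)
  then show ?thesis
    unfolding 1 by (simp add: diag_add diag_scaleC) (simp add: z_def norm_mult power_mult_distrib)
qed

theorem Cauchy_Schwarz: "(cmod (B x y))\<^sup>2 \<le> Re (B x x) * Re (B y y)"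
proof (cases "Re (B y y) = 0")
  case True
  have "0 \<le> Re (B x x) - 2 * s * (cmod (B x y))\<^sup>2" for s
    using nonneg[of "x - complex_of_real s *\<^sub>C (B x y *\<^sub>C y)"] True unfolding diag_diff_component by simp
  from this[of "(Re (B x x) + 1) / (2 * (cmod (B x y))\<^sup>2)"] have "cmod (B x y) = 0"
    by (cases "cmod (B x y) = 0") (simp_all add: divide_simps)
  with True show ?thesis by simp
next
  case False
  then have pos: "Re (B y y) > 0" using nonneg[of y] by linarith
  have "0 \<le> Re (B x x) - 2 * (1 / Re (B y y)) * (cmod (B x y))\<^sup>2
       + (1 / Re (B y y))\<^sup>2 * (cmod (B x y))\<^sup>2 * Re (B y y)"
    using nonneg[of "x - complex_of_real (1 / Re (B y y)) *\<^sub>C (B x y *\<^sub>C y)"]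
    by (simp only: diag_diff_component)
  also have "\<dots> = Re (B x x) - (cmod (B x y))\<^sup>2 / Re (B y y)"
    using pos by (simp add: field_simps power2_eq_square)
  finally show ?thesis using pos by (simp add: field_simps)
qed

lemma eq_0_if_diag_eq_0: "Re (B y y) = 0 \<Longrightarrow> B x y = 0"
  using Cauchy_Schwarz[of x y] by simp

text \<open>One step of Cholesky elimination. By the Cauchy-Schwarz inequality, subtracting the rank
  one form through \<open>z\<close> leaves a positive form, which vanishes at \<open>z\<close>. If \<open>B z z = 0\<close>, the
  quotient is \<open>0\<close> and nothing is subtracted.\<close>

lemma eliminate: "positive_form (\<lambda>x y. B x y - B x z * B z y / B z z)"
proof
  fix x y w c
  show "B (x + y) w - B (x + y) z * B z w / B z z =
      B x w - B x z * B z w / B z z + (B y w - B y z * B z w / B z z)"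
    by (simp add: add_left ring_distribs add_divide_distrib)
  show "B (c *\<^sub>C x) w - B (c *\<^sub>C x) z * B z w / B z z = c * (B x w - B x z * B z w / B z z)"
    by (simp add: scaleC_left ring_distribs)
  show "B x y - B x z * B z y / B z z = cnj (B y x - B y z * B z x / B z z)"
    using hermitian[of x y] hermitian[of x z] hermitian[of y z] hermitian[of z z] hermitian[of z y]
    by (metis complex_cnj_diff complex_cnj_divide complex_cnj_mult mult.commute)
  have "B x z * B z x = complex_of_real ((cmod (B x z))\<^sup>2)"
    using hermitian[of z x] by (simp only: complex_norm_square)
  then have "B x z * B z x / B z z = complex_of_real ((cmod (B x z))\<^sup>2 / Re (B z z))"
    by (metis diag_real of_real_divide)
  moreover have "(cmod (B x z))\<^sup>2 / Re (B z z) \<le> Re (B x x)"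
    using Cauchy_Schwarz[of x z] nonneg[of z] nonneg[of x]
    by (cases "Re (B z z) = 0") (auto simp: field_simps)
  ultimately show "0 \<le> Re (B x x - B x z * B z x / B z z)"
    by (simp del: of_real_divide of_real_power)
qed

end

interpretation cinner: positive_form "cinner :: 'a::complex_hilbert \<Rightarrow> 'a \<Rightarrow> complex"
proof
  show "0 \<le> Re (cinner x x)" for x :: 'a
    by (simp add: cinner_self del: of_real_power)
qed (rule cinner_add_left cinner_scaleC_left cinner_commute)+

section \<open>Geometry of the Hilbert space\<close>

lemma norm_power2_eq_cinner: "(norm x)\<^sup>2 = Re (cinner x x)"
  by (simp add: cinner_self del: of_real_power)

lemma norm_scaleC: "norm (c *\<^sub>C x) = cmod c * norm (x :: 'a::complex_hilbert)"
proof -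
  have "(norm (c *\<^sub>C x))\<^sup>2 = (cmod c * norm x)\<^sup>2"
    using cinner.diag_scaleC[of c x] by (simp add: norm_power2_eq_cinner power_mult_distrib)
  then show ?thesis by (simp add: power2_eq_iff_nonneg)
qed

lemma cmod_cinner_le: "cmod (cinner x y) \<le> norm x * norm (y :: 'a::complex_hilbert)"
proof (rule power2_le_imp_le)
  show "(cmod (cinner x y))\<^sup>2 \<le> (norm x * norm y)\<^sup>2"
    using cinner.Cauchy_Schwarz[of x y] by (simp add: norm_power2_eq_cinner power_mult_distrib)
qed simp

lemma bounded_bilinear_cinner:
  "bounded_bilinear (cinner :: 'a::complex_hilbert \<Rightarrow> 'a \<Rightarrow> complex)"
proof
  show "\<exists>K. \<forall>x y::'a. norm (cinner x y) \<le> norm x * norm y * K"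
    by (rule exI[of _ 1]) (simp add: cmod_cinner_le)
qed (simp_all add: cinner.add_left cinner.add_right cinner.scaleR_left cinner.scaleR_right
      scaleR_conv_of_real)

definition orthonormal_on :: "'i set \<Rightarrow> ('i \<Rightarrow> 'a::complex_hilbert) \<Rightarrow> bool" where
  "orthonormal_on I u \<longleftrightarrow> (\<forall>i\<in>I. \<forall>j\<in>I. cinner (u i) (u j) = (if i = j then 1 else 0))"

definition expansion :: "'i set \<Rightarrow> ('i \<Rightarrow> 'a::complex_hilbert) \<Rightarrow> 'a \<Rightarrow> 'a" where
  "expansion I u x = (\<Sum>i\<in>I. cinner x (u i) *\<^sub>C u i)"

lemma expansion_add: "expansion I u (x + y) = expansion I u x + expansion I u y"
  by (simp add: expansion_def cinner_add_left scaleC_add_left sum.distrib)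

lemma expansion_scaleC: "expansion I u (c *\<^sub>C x) = c *\<^sub>C expansion I u x"
  by (simp add: expansion_def cinner_scaleC_left complex_vector.scale_sum_right scaleC_scaleC)

lemma expansion_diff: "expansion I u (x - y) = expansion I u x - expansion I u y"
  by (simp add: expansion_def cinner.diff_left complex_vector.scale_left_diff_distrib sum_subtractf)

lemma cinner_expansion:
  assumes "finite I" "orthonormal_on I u" "j \<in> I"
  shows "cinner (expansion I u x) (u j) = cinner x (u j)"
proof -
  have "cinner (expansion I u x) (u j) = (\<Sum>i\<in>I. if i = j then cinner x (u i) else 0)"
    unfolding expansion_def cinner.sum_left
    using assms by (intro sum.cong) (auto simp: cinner_scaleC_left orthonormal_on_def)
  then show ?thesis using assms by simp
qed

lemma expansion_basis_vector:
  assumes "finite I" "orthonormal_on I u" "j \<in> I"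
  shows "expansion I u (u j) = u j"
proof -
  have "expansion I u (u j) = (\<Sum>i\<in>I. if j = i then u i else 0)"
    unfolding expansion_def using assms
    by (intro sum.cong) (auto simp: orthonormal_on_def)
  then show ?thesis using assms by simp
qed

lemma cinner_expansion_self:
  assumes "finite I" "orthonormal_on I u"
  shows "cinner (expansion I u x) (expansion I u x) = complex_of_real (\<Sum>i\<in>I. (cmod (cinner x (u i)))\<^sup>2)"
    and "cinner x (expansion I u x) = complex_of_real (\<Sum>i\<in>I. (cmod (cinner x (u i)))\<^sup>2)"
proof -
  have *: "cinner (expansion I u x) y = (\<Sum>i\<in>I. cinner x (u i) * cnj (cinner y (u i)))" for y
    by (simp add: expansion_def cinner.sum_left cinner_scaleC_left cinner_commute[of y])
  show 1: "cinner (expansion I u x) (expansion I u x) = complex_of_real (\<Sum>i\<in>I. (cmod (cinner x (u i)))\<^sup>2)"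
    unfolding *[of "expansion I u x"] of_real_sum complex_norm_square
    using assms by (intro sum.cong) (simp_all add: cinner_expansion)
  have "cinner (expansion I u x) x = complex_of_real (\<Sum>i\<in>I. (cmod (cinner x (u i)))\<^sup>2)"
    by (simp only: * of_real_sum complex_norm_square)
  then show "cinner x (expansion I u x) = complex_of_real (\<Sum>i\<in>I. (cmod (cinner x (u i)))\<^sup>2)"
    by (metis cinner_commute complex_cnj_complex_of_real)
qed

lemma norm_expansion:
  assumes "finite I" "orthonormal_on I u"
  shows "(norm (expansion I u x))\<^sup>2 = (\<Sum>i\<in>I. (cmod (cinner x (u i)))\<^sup>2)"
  using cinner_expansion_self(1)[OF assms, of x]
  by (simp add: norm_power2_eq_cinner del: of_real_sum of_real_power)

theorem Bessel_inequality:
  assumes "finite I" "orthonormal_on I u"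
  shows "(\<Sum>i\<in>I. (cmod (cinner x (u i)))\<^sup>2) \<le> (norm x)\<^sup>2"
proof -
  let ?p = "expansion I u x"
  have "Re (cinner x x) = Re (cinner (x - ?p) (x - ?p)) + (\<Sum>i\<in>I. (cmod (cinner x (u i)))\<^sup>2)"
    using cinner_expansion_self[OF assms, of x] cinner_commute[of ?p x]
    by (simp add: cinner.diff_left cinner.diff_right del: of_real_sum of_real_power)
  then show ?thesis
    using cinner.nonneg[of "x - ?p"] by (simp add: norm_power2_eq_cinner)
qed

lemma norm_expansion_le:
  assumes "finite I" "orthonormal_on I u"
  shows "norm (expansion I u x) \<le> norm x"
  using Bessel_inequality[OF assms, of x] norm_expansion[OF assms, of x]
  by (simp add: power2_le_imp_le)

lemma orthonormal_basis_orthonormal_on: "orthonormal_basis e \<Longrightarrow> orthonormal_on I e"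
  by (simp add: orthonormal_basis_def orthonormal_on_def)

text \<open>A vector of the algebraic span only involves finitely many basis vectors, so the partial
  expansions reproduce it exactly from some point on.\<close>

lemma expansion_eq_eventually:
  assumes e: "orthonormal_basis e" and y: "y \<in> cspan (range e)"
  shows "\<forall>\<^sub>F N in sequentially. expansion {..<N} e y = y"
  using y
proof (induction rule: complex_vector.span_induct_alt)
  case base
  show ?case by (simp add: expansion_def cinner.zero_left)
next
  case (step c x y)
  from step(1) obtain n where n: "x = e n" by blast
  have "\<forall>\<^sub>F N in sequentially. n < N" by (rule eventually_gt_at_top)
  with step(2) show ?case
  proof eventually_elim
    case (elim N)
    then show ?case
      using expansion_basis_vector[OF _ orthonormal_basis_orthonormal_on[OF e], of "{..<N}" n]
      by (simp add: expansion_add expansion_scaleC n)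
  qed
qed

text \<open>Density of the span suffices because the partial expansions are uniformly contractive.\<close>

theorem expansion_tendsto:
  assumes e: "orthonormal_basis e"
  shows "(\<lambda>N. expansion {..<N} e x) \<longlonglongrightarrow> x"
proof (rule tendstoI)
  fix r :: real assume "r > 0"
  have "x \<in> closure (cspan (range e))" using e by (simp add: orthonormal_basis_def)
  then obtain y where y: "y \<in> cspan (range e)" "dist y x < r / 2"
    using \<open>r > 0\<close> by (meson closure_approachable half_gt_zero)
  from expansion_eq_eventually[OF e y(1)]
  show "\<forall>\<^sub>F N in sequentially. dist (expansion {..<N} e x) x < r"
  proof eventually_elim
    case (elim N)
    have "expansion {..<N} e x - x = expansion {..<N} e (x - y) - (x - y)"
      using elim by (simp add: expansion_diff)
    then have "norm (expansion {..<N} e x - x) \<le> norm (expansion {..<N} e (x - y)) + norm (x - y)"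
      by (metis norm_triangle_ineq4)
    also have "norm (expansion {..<N} e (x - y)) \<le> norm (x - y)"
      by (rule norm_expansion_le) (simp_all add: orthonormal_basis_orthonormal_on[OF e])
    finally show ?case using y(2) by (simp add: dist_norm norm_minus_commute)
  qed
qed

theorem Parseval:
  assumes e: "orthonormal_basis e"
  shows "((\<lambda>n. (cmod (cinner x (e n)))\<^sup>2) has_sum (norm x)\<^sup>2) UNIV"
proof (rule norm_summable_imp_has_sum)
  have "(\<lambda>N. (norm (expansion {..<N} e x))\<^sup>2) \<longlonglongrightarrow> (norm x)\<^sup>2"
    by (intro tendsto_intros expansion_tendsto[OF e])
  then show *: "(\<lambda>n. (cmod (cinner x (e n)))\<^sup>2) sums (norm x)\<^sup>2"
    by (simp add: sums_def norm_expansion orthonormal_basis_orthonormal_on[OF e])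
  show "summable (\<lambda>n. norm ((cmod (cinner x (e n)))\<^sup>2))"
    using sums_summable[OF *] by simp
qed

section \<open>Orthogonal projections\<close>

lemma parallelogram:
  "(norm (x + y))\<^sup>2 + (norm (x - y))\<^sup>2 = 2 * (norm x)\<^sup>2 + 2 * (norm (y :: 'a::complex_hilbert))\<^sup>2"
  by (simp add: norm_power2_eq_cinner cinner.add_left cinner.add_right cinner.diff_left cinner.diff_right)

lemma closed_csubspaceD:
  assumes "closed_csubspace S"
  shows "0 \<in> S" "x \<in> S \<Longrightarrow> y \<in> S \<Longrightarrow> x + y \<in> S" "x \<in> S \<Longrightarrow> y \<in> S \<Longrightarrow> x - y \<in> S"
    "x \<in> S \<Longrightarrow> c *\<^sub>C x \<in> S" "x \<in> S \<Longrightarrow> r *\<^sub>R x \<in> S" "closed S"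
  using assms complex_vector.subspace_0 complex_vector.subspace_add complex_vector.subspace_diff
    complex_vector.subspace_scale
  by (auto simp: closed_csubspace_def simp flip: scaleC_of_real)

text \<open>A minimizing sequence is Cauchy by the parallelogram identity: the midpoint of two of its
  members lies in \<open>S\<close> and cannot be nearer to \<open>x\<close> than the infimum.\<close>

lemma nearest_point_exists:
  assumes S: "closed_csubspace S"
  shows "\<exists>y\<in>S. \<forall>z\<in>S. (norm (x - y))\<^sup>2 \<le> (norm (x - z))\<^sup>2"
proof -
  define D where "D = (INF z\<in>S. (norm (x - z))\<^sup>2)"
  have bdd: "bdd_below ((\<lambda>z. (norm (x - z))\<^sup>2) ` S)"
    by (rule bdd_belowI2[of _ 0]) simp
  have D: "D \<le> (norm (x - z))\<^sup>2" if "z \<in> S" for z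
    unfolding D_def by (rule cINF_lower[OF bdd that])
  have "\<exists>z\<in>S. (norm (x - z))\<^sup>2 < D + 1 / Suc n" for n
  proof (rule ccontr)
    assume "\<not> ?thesis"
    then have "D + 1 / Suc n \<le> D"
      unfolding D_def using closed_csubspaceD(1)[OF S]
      by (intro cINF_greatest) (auto simp: not_less D_def)
    then show False by (simp add: field_simps)
  qed
  then obtain s where s: "\<And>n. s n \<in> S" "\<And>n. (norm (x - s n))\<^sup>2 < D + 1 / Suc n"
    by metis
  have bound: "(norm (s m - s n))\<^sup>2 \<le> 2 / Suc m + 2 / Suc n" for m n
  proof -
    have "(norm ((x - s m) + (x - s n)))\<^sup>2 + (norm ((x - s m) - (x - s n)))\<^sup>2
        = 2 * (norm (x - s m))\<^sup>2 + 2 * (norm (x - s n))\<^sup>2"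
      by (rule parallelogram)
    moreover have "(x - s m) + (x - s n) = 2 *\<^sub>R (x - (1/2) *\<^sub>R (s m + s n))"
      by (simp add: algebra_simps scaleR_2)
    then have "(norm ((x - s m) + (x - s n)))\<^sup>2 = 4 * (norm (x - (1/2) *\<^sub>R (s m + s n)))\<^sup>2"
      by (simp add: power_mult_distrib)
    moreover have "D \<le> (norm (x - (1/2) *\<^sub>R (s m + s n)))\<^sup>2"
      by (intro D closed_csubspaceD[OF S] s)
    moreover have "norm ((x - s m) - (x - s n)) = norm (s m - s n)"
      by (simp add: norm_minus_commute)
    ultimately show ?thesis using s(2)[of m] s(2)[of n] by simp
  qed
  have "Cauchy s"
  proof (rule metric_CauchyI)
    fix r :: real assume r: "r > 0"
    obtain M where M: "4 / r\<^sup>2 < real M" using reals_Archimedean2 by blast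
    have "norm (s m - s n) < r" if "m \<ge> M" "n \<ge> M" for m n
    proof (rule power2_less_imp_less)
      have "M > 0" using M r by (cases M) (auto simp: field_simps)
      then have "2 / Suc m \<le> 2 / real M" "2 / Suc n \<le> 2 / real M"
        using that by (auto intro!: divide_left_mono)
      then have "(norm (s m - s n))\<^sup>2 \<le> 4 / M" using bound[of m n] by simp
      also have "\<dots> < r\<^sup>2" using M r \<open>M > 0\<close> by (simp add: field_simps)
      finally show "(norm (s m - s n))\<^sup>2 < r\<^sup>2" .
    qed (use r in simp)
    then show "\<exists>M. \<forall>m\<ge>M. \<forall>n\<ge>M. dist (s m) (s n) < r" by (auto simp: dist_norm)
  qed
  then obtain y where y: "s \<longlonglongrightarrow> y" using Cauchy_convergent_iff convergent_def by blast
  have "y \<in> S" using closed_sequentially[OF closed_csubspaceD(6)[OF S]] s(1) y by blast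
  moreover have "(norm (x - y))\<^sup>2 \<le> D"
  proof (rule LIMSEQ_le)
    show "(\<lambda>n. (norm (x - s n))\<^sup>2) \<longlonglongrightarrow> (norm (x - y))\<^sup>2" by (intro tendsto_intros y)
    have "(\<lambda>n. D + 1 / Suc n) \<longlonglongrightarrow> D + 0"
      by (intro tendsto_intros LIMSEQ_Suc[OF lim_1_over_n])
    then show "(\<lambda>n. D + 1 / Suc n) \<longlonglongrightarrow> D" by simp
    show "\<exists>N. \<forall>n\<ge>N. (norm (x - s n))\<^sup>2 \<le> D + 1 / Suc n" using s(2) less_imp_le by blast
  qed
  ultimately show ?thesis using D order_trans by blast
qed

text \<open>The residual at a nearest point is orthogonal to \<open>S\<close>: otherwise a small step along \<open>S\<close> would
  come closer to \<open>x\<close>.\<close>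

theorem orthogonal_projection_exists:
  assumes S: "closed_csubspace S"
  shows "\<exists>!y. y \<in> S \<and> (\<forall>z\<in>S. cinner (x - y) z = 0)"
proof -
  obtain y where y: "y \<in> S" "\<And>z. z \<in> S \<Longrightarrow> (norm (x - y))\<^sup>2 \<le> (norm (x - z))\<^sup>2"
    using nearest_point_exists[OF S] by blast
  have "cinner (x - y) z = 0" if z: "z \<in> S" for z
  proof -
    define b where "b = (cmod (cinner (x - y) z))\<^sup>2"
    (* Any step strictly between 0 and 2 / (norm z)^2 works; the added 1 covers z = 0. *)
    define s where "s = 1 / ((norm z)\<^sup>2 + 1)"
    have nz: "(norm z)\<^sup>2 + 1 > 0" by (simp add: add_nonneg_pos)
    have "y + complex_of_real s *\<^sub>C (cinner (x - y) z *\<^sub>C z) \<in> S"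
      by (intro closed_csubspaceD[OF S] y z)
    from y(2)[OF this] have "Re (cinner (x - y) (x - y)) \<le>
       Re (cinner (x - y - complex_of_real s *\<^sub>C (cinner (x - y) z *\<^sub>C z))
         (x - y - complex_of_real s *\<^sub>C (cinner (x - y) z *\<^sub>C z)))"
      by (simp add: norm_power2_eq_cinner diff_diff_add)
    then have "2 * s * b \<le> s\<^sup>2 * b * (norm z)\<^sup>2"
      unfolding cinner.diag_diff_component by (simp add: b_def norm_power2_eq_cinner)
    then have "2 * b * ((norm z)\<^sup>2 + 1) \<le> b * (norm z)\<^sup>2"
      using nz unfolding s_def power_one_over power2_eq_square[of "(norm z)\<^sup>2 + 1"]
      by (simp add: divide_simps mult_ac)
    then have "b * ((norm z)\<^sup>2 + 2) \<le> 0" by (simp add: algebra_simps)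
    moreover have "b \<ge> 0" by (simp add: b_def)
    moreover have "(norm z)\<^sup>2 + 2 > 0" using nz by linarith
    ultimately have "b = 0" by (smt (verit) mult_pos_pos)
    then show ?thesis by (simp add: b_def)
  qed
  moreover have "y' = y" if "y' \<in> S" "\<forall>z\<in>S. cinner (x - y') z = 0" for y'
  proof -
    have yy: "y - y' \<in> S" using y(1) that(1) by (intro closed_csubspaceD[OF S])
    have "cinner ((x - y') - (x - y)) (y - y') = 0"
      unfolding cinner.diff_left[of "x - y'" "x - y"] using yy that(2) calculation by simp
    then have "(norm (y - y'))\<^sup>2 = 0" by (simp add: norm_power2_eq_cinner)
    then show ?thesis by simp
  qed
  ultimately show ?thesis using y(1) by blast
qed

lemma proj_in: "closed_csubspace S \<Longrightarrow> proj S x \<in> S"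
  and cinner_proj: "closed_csubspace S \<Longrightarrow> z \<in> S \<Longrightarrow> cinner (proj S x) z = cinner x z"
proof -
  assume "closed_csubspace S"
  from theI'[OF orthogonal_projection_exists[OF this], of x]
  have *: "proj S x \<in> S \<and> (\<forall>z\<in>S. cinner (x - proj S x) z = 0)" by (simp add: proj_def)
  then show "proj S x \<in> S" "z \<in> S \<Longrightarrow> cinner (proj S x) z = cinner x z"
    by (auto simp: cinner.diff_left)
qed

lemma proj_eq_iff: "closed_csubspace S \<Longrightarrow> proj S x = x \<longleftrightarrow> x \<in> S"
proof
  assume S: "closed_csubspace S" and x: "x \<in> S"
  show "proj S x = x"
    unfolding proj_def
    by (rule the1_equality[OF orthogonal_projection_exists[OF S]]) (simp add: x cinner.zero_left)
qed (metis proj_in)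

lemma cinner_proj_right: "closed_csubspace S \<Longrightarrow> z \<in> S \<Longrightarrow> cinner z (proj S x) = cinner z x"
  using cinner_proj cinner_commute by metis

section \<open>The trace dominates every compression of a positive form\<close>

text \<open>For the rank one form \<open>\<langle>x, w\<rangle> \<langle>w, y\<rangle>\<close> with \<open>w\<close> in the span of the
  \<open>e n\<close> this is the Bessel inequality for \<open>w\<close>. Elimination writes a
  general positive form, restricted to the span of the \<open>e n\<close>, as a sum of rank one forms; each
  step makes at least one more diagonal entry vanish, and a form whose diagonal vanishes is \<open>0\<close>
  there.\<close>

lemma trace_compression_finite:
  assumes "positive_form B" "finite J" "orthonormal_on J e" "finite I" "orthonormal_on I u"
  shows "(\<Sum>i\<in>I. Re (B (expansion J e (u i)) (expansion J e (u i)))) \<le> (\<Sum>n\<in>J. Re (B (e n) (e n)))"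
  using assms(1)
proof (induction "card {n \<in> J. B (e n) (e n) \<noteq> 0}" arbitrary: B rule: less_induct)
  case less
  interpret positive_form B by fact
  show ?case
  proof (cases "\<exists>m\<in>J. B (e m) (e m) \<noteq> 0")
    case False
    then have "B (e n) x = 0" if "n \<in> J" for n x
      using that eq_0_if_diag_eq_0[of "e n" x] hermitian[of "e n" x] by simp
    then have "B (expansion J e x) y = 0" for x y
      by (simp add: expansion_def sum_left scaleC_left)
    with False show ?thesis by simp
  next
    case True
    then obtain m where m: "m \<in> J" "B (e m) (e m) \<noteq> 0" by blast
    define z where "z = e m"
    define B' where "B' = (\<lambda>x y. B x y - B x z * B z y / B z z)"
    have B': "positive_form B'" unfolding B'_def by (rule eliminate)
    have qz: "Re (B z z) > 0"
      using m nonneg[of z] diag_real[of z] unfolding z_def by (metis less_eq_real_def of_real_0)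
    have split: "Re (B x x) = Re (B' x x) + (cmod (B x z))\<^sup>2 / Re (B z z)" for x
    proof -
      have "B x z * B z x = complex_of_real ((cmod (B x z))\<^sup>2)"
        using hermitian[of z x] by (simp only: complex_norm_square)
      then have "B x z * B z x / B z z = complex_of_real ((cmod (B x z))\<^sup>2 / Re (B z z))"
        by (metis diag_real of_real_divide)
      then show ?thesis by (simp add: B'_def del: of_real_divide of_real_power)
    qed
    have split_I: "(\<Sum>i\<in>I. Re (B (expansion J e (u i)) (expansion J e (u i))))
        = (\<Sum>i\<in>I. Re (B' (expansion J e (u i)) (expansion J e (u i))))
          + (\<Sum>i\<in>I. (cmod (B (expansion J e (u i)) z))\<^sup>2) / Re (B z z)"
      and split_J: "(\<Sum>n\<in>J. Re (B (e n) (e n)))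
        = (\<Sum>n\<in>J. Re (B' (e n) (e n))) + (\<Sum>n\<in>J. (cmod (B (e n) z))\<^sup>2) / Re (B z z)"
      unfolding sum_divide_distrib sum.distrib[symmetric] by (rule sum.cong[OF refl split])+
    have "{n \<in> J. B' (e n) (e n) \<noteq> 0} \<subset> {n \<in> J. B (e n) (e n) \<noteq> 0}"
    proof
      show "{n \<in> J. B' (e n) (e n) \<noteq> 0} \<subseteq> {n \<in> J. B (e n) (e n) \<noteq> 0}"
        by (auto simp: B'_def eq_0_if_diag_eq_0)
      have "B' (e m) (e m) = 0" using m by (simp add: B'_def z_def)
      then show "{n \<in> J. B' (e n) (e n) \<noteq> 0} \<noteq> {n \<in> J. B (e n) (e n) \<noteq> 0}" using m by blast
    qed
    then have "card {n \<in> J. B' (e n) (e n) \<noteq> 0} < card {n \<in> J. B (e n) (e n) \<noteq> 0}"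
      using \<open>finite J\<close> by (intro psubset_card_mono) auto
    from less.hyps[OF this B']
    have IH: "(\<Sum>i\<in>I. Re (B' (expansion J e (u i)) (expansion J e (u i)))) \<le> (\<Sum>n\<in>J. Re (B' (e n) (e n)))" .
    (* The vector in the span of the e n that represents the functional B _ z on it. *)
    define w where "w = (\<Sum>n\<in>J. cnj (B (e n) z) *\<^sub>C e n)"
    have w: "cinner x w = B (expansion J e x) z" for x
    proof -
      have "cinner w x = (\<Sum>n\<in>J. cnj (B (e n) z) * cinner (e n) x)"
        by (simp add: w_def cinner.sum_left cinner_scaleC_left)
      then have "cinner x w = (\<Sum>n\<in>J. B (e n) z * cnj (cinner (e n) x))"
        using cinner_commute[of x w] by simp
      then have "cinner x w = (\<Sum>n\<in>J. B (e n) z * cinner x (e n))"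
        by (simp flip: cinner_commute)
      then show ?thesis by (simp add: expansion_def sum_left scaleC_left mult.commute)
    qed
    have we: "cinner w (e n) = cnj (B (e n) z)" if "n \<in> J" for n
      using w[of "e n"] expansion_basis_vector[OF assms(2,3) that] cinner_commute[of w "e n"] by simp
    have "(norm w)\<^sup>2 = (\<Sum>n\<in>J. (cmod (B (e n) z))\<^sup>2)"
    proof -
      have "w = expansion J e w" unfolding expansion_def by (simp add: we) (simp add: w_def)
      then show ?thesis using norm_expansion[OF assms(2,3), of w] by (simp add: we)
    qed
    moreover have "cmod (cinner w x) = cmod (B (expansion J e x) z)" for x
      using cinner_commute[of w x] w[of x] by simp
    ultimately have "(\<Sum>i\<in>I. (cmod (B (expansion J e (u i)) z))\<^sup>2) \<le> (\<Sum>n\<in>J. (cmod (B (e n) z))\<^sup>2)"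
      using Bessel_inequality[OF assms(4,5), of w] by simp
    then have "(\<Sum>i\<in>I. (cmod (B (expansion J e (u i)) z))\<^sup>2) / Re (B z z)
        \<le> (\<Sum>n\<in>J. (cmod (B (e n) z))\<^sup>2) / Re (B z z)"
      using qz by (intro divide_right_mono) auto
    with IH show ?thesis
      unfolding split_I split_J by linarith
  qed
qed

text \<open>Hermitian symmetry comes from polarization: the diagonal values at \<open>x + y\<close> and \<open>x + \<i> y\<close> are real.\<close>

lemma positive_form_of_positive_op:
  assumes "positive_op Y"
  shows "positive_form (\<lambda>x y. cinner (Y x) y)"
proof
  have lin: "bounded_linear Y" and hom: "\<And>c x. Y (c *\<^sub>C x) = c *\<^sub>C Y x"
    and pos: "\<And>x. cinner (Y x) x \<in> \<real>\<^sub>\<ge>\<^sub>0"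
    using assms by (auto simp: positive_op_def bounded_op_def)
  note add = linear_add[OF bounded_linear.linear[OF lin]]
  fix x y z c
  show "cinner (Y (x + y)) z = cinner (Y x) z + cinner (Y y) z"
    by (simp add: add cinner_add_left)
  show "cinner (Y (c *\<^sub>C x)) z = c * cinner (Y x) z"
    by (simp add: hom cinner_scaleC_left)
  have real: "Im (cinner (Y x) x) = 0" for x
    using pos[of x] by (auto simp: complex_nonneg_Reals_iff)
  show "0 \<le> Re (cinner (Y x) x)"
    using pos[of x] by (auto simp: complex_nonneg_Reals_iff)
  have "Im (cinner (Y x) y) + Im (cinner (Y y) x) = 0"
    using real[of "x + y"] real[of x] real[of y] by (simp add: add cinner.add_left cinner.add_right)
  moreover have "Re (cinner (Y y) x) - Re (cinner (Y x) y) = 0"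
    using real[of "x + \<i> *\<^sub>C y"] real[of x] real[of y]
    by (simp add: add hom cinner.add_left cinner.add_right cinner.scaleC_left cinner.scaleC_right)
  ultimately show "cinner (Y x) y = cnj (cinner (Y y) x)"
    by (simp add: complex_eq_iff)
qed

section \<open>Density operators\<close>

text \<open>The finite inequality is applied to the expansions of the \<open>u i\<close> in the first \<open>N\<close> basis vectors,
  where the right-hand side is at most the whole trace; boundedness of \<open>Y\<close> gives the limit.\<close>

theorem density_compression_le_1:
  assumes e: "orthonormal_basis e" and Y: "Y \<in> density_ops e S"
    and I: "finite I" "orthonormal_on I u"
  shows "(\<Sum>i\<in>I. Re (cinner (Y (u i)) (u i))) \<le> 1"
proof -
  have pos: "positive_op Y" and tr: "(\<Sum>\<^sub>\<infinity>n. cinner (Y (e n)) (e n)) = 1"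
    using Y by (auto simp: density_ops_def op_trace_def)
  have lin: "bounded_linear Y" using pos by (simp add: positive_op_def bounded_op_def)
  interpret q: positive_form "\<lambda>x y. cinner (Y x) y"
    by (rule positive_form_of_positive_op[OF pos])
  (* An infinite sum that does not converge has the value 0, so the trace 1 is a genuine sum. *)
  have "(\<lambda>n. cinner (Y (e n)) (e n)) summable_on UNIV"
    using infsum_not_exists tr by (metis (no_types, lifting) zero_neq_one)
  with tr have "((\<lambda>n. cinner (Y (e n)) (e n)) has_sum 1) UNIV"
    by (simp add: summable_iff_has_sum_infsum)
  then have diag: "((\<lambda>n. Re (cinner (Y (e n)) (e n))) has_sum 1) UNIV"
    using has_sum_Re[where a=1] one_complex.sel(1) by metis
  have "(\<Sum>i\<in>I. Re (cinner (Y (expansion {..<N} e (u i))) (expansion {..<N} e (u i)))) \<le> 1" for N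
  proof -
    have "(\<Sum>i\<in>I. Re (cinner (Y (expansion {..<N} e (u i))) (expansion {..<N} e (u i))))
       \<le> (\<Sum>n<N. Re (cinner (Y (e n)) (e n)))"
      using trace_compression_finite[OF q.positive_form_axioms, of "{..<N}" e I u] I
        orthonormal_basis_orthonormal_on[OF e] by blast
    also have "\<dots> \<le> 1"
      by (rule finite_sum_le_has_sum[OF diag]) (simp_all add: q.nonneg)
    finally show ?thesis .
  qed
  moreover have "(\<lambda>N. \<Sum>i\<in>I. Re (cinner (Y (expansion {..<N} e (u i))) (expansion {..<N} e (u i))))
      \<longlonglongrightarrow> (\<Sum>i\<in>I. Re (cinner (Y (u i)) (u i)))"
    by (intro tendsto_sum tendsto_Re bounded_bilinear.tendsto[OF bounded_bilinear_cinner]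
        bounded_linear.tendsto[OF lin] expansion_tendsto[OF e])
  ultimately show ?thesis by (intro LIMSEQ_le_const2) auto
qed

lemma rank_one_diagonal:
  "cinner (cinner x f *\<^sub>C f) x = complex_of_real ((cmod (cinner f x))\<^sup>2)"
  using cinner_commute[of x f]
  by (simp add: cinner_scaleC_left complex_norm_square mult.commute del: of_real_power)

text \<open>A rank one projection is positive and idempotent, hence its own absolute value; its trace is
  \<open>1\<close> by the Parseval identity.\<close>

lemma rank_one_density:
  assumes e: "orthonormal_basis e" and S: "closed_csubspace S" and f: "f \<in> S" "norm f = 1"
  shows "(\<lambda>x. cinner x f *\<^sub>C f) \<in> density_ops e S"
proof -
  let ?Y = "\<lambda>x. cinner x f *\<^sub>C f"
  have ff: "cinner f f = 1" using f by (simp add: cinner_self)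
  note diag = rank_one_diagonal
  have bnd: "bounded_op ?Y"
    unfolding bounded_op_def
  proof (intro conjI allI)
    show "bounded_linear ?Y"
    proof (rule bounded_linear_intro)
      show "norm (?Y x) \<le> norm x * 1" for x
        using cmod_cinner_le[of x f] f by (simp add: norm_scaleC)
      show "?Y (r *\<^sub>R x) = r *\<^sub>R ?Y x" for r x
        by (simp add: cinner.scaleR_left) (simp flip: scaleC_of_real add: scaleC_scaleC)
    qed (simp add: cinner_add_left scaleC_add_left)
  qed (simp add: cinner_scaleC_left scaleC_scaleC)
  have pos: "positive_op ?Y"
    unfolding positive_op_def
  proof (intro conjI allI bnd)
    show "cinner (?Y x) x \<in> \<real>\<^sub>\<ge>\<^sub>0" for x
      unfolding diag by (simp del: of_real_power)
  qed
  have "is_abs_op ?Y ?Y"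
    unfolding is_abs_op_def
  proof (intro conjI pos allI)
    show "cinner (?Y (?Y x)) y = cinner (?Y x) (?Y y)" for x y
      using cinner_commute[of f y] by (simp add: cinner_scaleC_left cinner.scaleC_right ff)
  qed
  moreover have tr: "((\<lambda>n. cinner (?Y (e n)) (e n)) has_sum 1) UNIV"
    using Parseval[OF e, of f] f unfolding diag by (metis has_sum_of_real of_real_1 one_power2)
  then have "(\<lambda>n. cinner (?Y (e n)) (e n)) summable_on UNIV" "op_trace e ?Y = 1"
    unfolding op_trace_def by (auto simp: has_sum_imp_summable infsumI)
  moreover have "proj S (?Y x) = ?Y x" for x
    unfolding proj_eq_iff[OF S] by (rule closed_csubspaceD(4)[OF S f(1)])
  ultimately show ?thesis
    using bnd pos by (auto simp: density_ops_def trace_class_def)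
qed

lemma rank_one_moment:
  assumes "orthonormal_basis e" "closed_csubspace S" "f \<in> S" "norm f = 1"
  shows "(\<lambda>n. (cmod (cinner f (e n)))\<^sup>2) \<in> moment_set e S"
proof -
  have "Re (cinner (cinner (e n) f *\<^sub>C f) (e n)) = (cmod (cinner f (e n)))\<^sup>2" for n
    by (simp add: rank_one_diagonal del: of_real_power)
  then show ?thesis
    unfolding moment_set_def
    by (intro image_eqI[OF _ rank_one_density[OF assms]]) auto
qed

lemma principal_vec_in: "closed_csubspace S \<Longrightarrow> principal_vec e S j \<in> S"
  unfolding principal_vec_def by (intro closed_csubspaceD(5) proj_in)

lemma proj_eq_principal_vec:
  "proj S (e j) = norm (proj S (e j)) *\<^sub>R principal_vec e S j"
  by (cases "proj S (e j) = 0") (simp_all add: principal_vec_def)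

lemma coordinate_eq_cinner_principal_vec:
  assumes "closed_csubspace S" "x \<in> S"
  shows "cinner x (e j) = complex_of_real (norm (proj S (e j))) * cinner x (principal_vec e S j)"
  using cinner_proj_right[OF assms, of "e j"] cinner.scaleR_right proj_eq_principal_vec by metis

text \<open>Since the range of \<open>Y\<close> lies in \<open>S\<close>, the second argument of the form may be projected to \<open>S\<close>, and by
  hermitian symmetry so may the first.\<close>

lemma density_diagonal:
  assumes S: "closed_csubspace S" and Y: "Y \<in> density_ops e S"
  shows "Re (cinner (Y (e j)) (e j))
    = (norm (proj S (e j)))\<^sup>2 * Re (cinner (Y (principal_vec e S j)) (principal_vec e S j))"
proof -
  have pos: "positive_op Y" and YS: "\<And>x. Y x \<in> S"
    using Y proj_eq_iff[OF S] by (auto simp: density_ops_def)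
  interpret q: positive_form "\<lambda>x y. cinner (Y x) y"
    by (rule positive_form_of_positive_op[OF pos])
  let ?a = "proj S (e j)"
  have right: "cinner (Y x) (e j) = cinner (Y x) ?a" for x
    using cinner_proj_right[OF S YS] by simp
  have "cinner (Y (e j)) (e j) = cnj (cinner (Y ?a) (e j))"
    using right[of "e j"] q.hermitian[of "e j" ?a] by simp
  also have "\<dots> = cinner (Y ?a) ?a"
    using right[of ?a] q.hermitian by metis
  finally have "Re (cinner (Y (e j)) (e j)) = Re (cinner (Y ?a) ?a)" by simp
  also have "\<dots> = (norm ?a)\<^sup>2 * Re (cinner (Y (principal_vec e S j)) (principal_vec e S j))"
    by (subst (1 2) proj_eq_principal_vec)
      (simp add: q.scaleR_left cinner.scaleR_right power2_eq_square)
  finally show ?thesis .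
qed

text \<open>The expectation at \<open>f\<close> uses up the whole trace, so the form vanishes at every \<open>g\<close> orthogonal to \<open>f\<close>,
  and by the Cauchy-Schwarz inequality mixed terms with \<open>g\<close> vanish too. Only the component of \<open>x\<close>
  along \<open>f\<close> contributes.\<close>

lemma density_pure_diagonal:
  assumes e: "orthonormal_basis e" and Y: "Y \<in> density_ops e S"
    and f: "norm f = 1" and Yf: "Re (cinner (Y f) f) = 1"
  shows "Re (cinner (Y x) x) = (cmod (cinner f x))\<^sup>2"
proof -
  have pos: "positive_op Y" using Y by (auto simp: density_ops_def)
  interpret q: positive_form "\<lambda>x y. cinner (Y x) y"
    by (rule positive_form_of_positive_op[OF pos])
  have ff: "cinner f f = 1" using f by (simp add: cinner_self)
  define g where "g = x - cinner x f *\<^sub>C f"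
  have gf: "cinner g f = 0"
    by (simp add: g_def cinner.diff_left cinner_scaleC_left ff)
  have g0: "Re (cinner (Y g) g) = 0"
  proof (cases "g = 0")
    case True
    then show ?thesis by (simp add: cinner.zero_left cinner.eq_0_if_diag_eq_0)
  next
    case False
    define h where "h = g /\<^sub>R norm g"
    have "orthonormal_on UNIV (\<lambda>b. if b then f else h)"
      using False gf cinner_commute[of f g] ff
      by (auto simp: orthonormal_on_def h_def cinner.scaleR_left cinner.scaleR_right cinner_self
          power2_eq_square field_simps)
    from density_compression_le_1[OF e Y _ this]
    have "Re (cinner (Y h) h) \<le> 0" using Yf by (simp add: UNIV_bool)
    moreover have "g = norm g *\<^sub>R h" using False by (simp add: h_def)
    then have "Re (cinner (Y g) g) = (norm g)\<^sup>2 * Re (cinner (Y h) h)"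
      using q.diag_scaleC[of "complex_of_real (norm g)" h] by (simp add: scaleC_of_real)
    ultimately show ?thesis
      using q.nonneg[of g] by (metis mult_nonneg_nonpos order_antisym zero_le_power2)
  qed
  have "x = cinner x f *\<^sub>C f + g" by (simp add: g_def)
  then have "Re (cinner (Y x) x) = (cmod (cinner x f))\<^sup>2"
    using q.diag_add[of "cinner x f *\<^sub>C f" g] q.diag_scaleC[of "cinner x f" f]
      q.eq_0_if_diag_eq_0[OF g0, of "cinner x f *\<^sub>C f"] g0 Yf by simp
  then show ?thesis using cinner_commute[of x f] by simp
qed

section \<open>Arcs of unit vectors\<close>

definition great_circle :: "'a::complex_hilbert \<Rightarrow> 'a \<Rightarrow> real \<Rightarrow> 'a" where
  "great_circle v z t = cos t *\<^sub>R v + sin t *\<^sub>R z"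

lemma great_circle_0: "great_circle v z 0 = v"
  by (simp add: great_circle_def)

lemma great_circle_in: "closed_csubspace S \<Longrightarrow> v \<in> S \<Longrightarrow> z \<in> S \<Longrightarrow> great_circle v z t \<in> S"
  unfolding great_circle_def by (intro closed_csubspaceD)

lemma cinner_great_circle:
  assumes "norm v = 1" "norm z = 1" "cinner z v = 0"
  shows "cinner (great_circle v z s) (great_circle v z t) = complex_of_real (cos (s - t))"
proof -
  have "cinner v z = 0" using assms(3) cinner_commute[of v z] by simp
  then show ?thesis
    using assms
    by (simp add: great_circle_def cinner.add_left cinner.add_right cinner.scaleR_left cinner.scaleR_right
        cinner_self cos_diff)
qed

lemma norm_great_circle:
  assumes "norm v = 1" "norm z = 1" "cinner z v = 0"
  shows "norm (great_circle v z t) = 1"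
  using cinner_great_circle[OF assms, of t t] norm_power2_eq_cinner[of "great_circle v z t"]
  by (simp add: power2_eq_1_iff) (metis norm_ge_zero not_one_le_zero neg_0_le_iff_le)

text \<open>The frame of the points at \<open>t\<close> and \<open>t + \<pi>/2\<close> replaces the frame \<open>v\<close>, \<open>z\<close>; in it the point at \<open>t\<close> is the
  first basis vector, and the support inequality there becomes a computation with a two by two
  matrix.\<close>

lemma great_circle_rotate: "great_circle v z s = cos (s - t) *\<^sub>R great_circle v z t + sin (s - t) *\<^sub>R great_circle v z (t + pi / 2)"
proof -
  have "cos s = cos ((s - t) + t)" "sin s = sin ((s - t) + t)" by simp_all
  then have "cos s = cos (s - t) * cos t - sin (s - t) * sin t"
    "sin s = sin (s - t) * cos t + cos (s - t) * sin t"
    unfolding cos_add sin_add by simp_all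
  then show ?thesis
    by (simp only: great_circle_def cos_add sin_add cos_pi_half sin_pi_half) (simp add: algebra_simps)
qed

lemma great_circle_orthonormal:
  assumes "norm v = 1" "norm z = 1" "cinner z v = 0"
  shows "orthonormal_on UNIV (\<lambda>b. if b then great_circle v z t else great_circle v z (t + pi / 2))"
  by (simp add: orthonormal_on_def cinner_great_circle[OF assms])

lemma density_great_circle_le_1:
  assumes "orthonormal_basis e" "Y \<in> density_ops e S"
    and "norm v = 1" "norm z = 1" "cinner z v = 0"
  shows "Re (cinner (Y (great_circle v z t)) (great_circle v z t))
    + Re (cinner (Y (great_circle v z (t + pi / 2))) (great_circle v z (t + pi / 2))) \<le> 1"
  using density_compression_le_1[OF assms(1,2) _ great_circle_orthonormal[OF assms(3-5), of t]]
  by (simp add: UNIV_bool add.commute)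

section \<open>The supporting functional\<close>

text \<open>In the frame of the points at \<open>t\<close> and \<open>t + \<pi>/2\<close> let \<open>a\<close>, \<open>b\<close> be the expectations of \<open>Y\<close> and \<open>h\<close> the real
  part of the mixed term. The plane curve \<open>(cos\<^sup>2 t, cos\<^sup>2 (\<theta> - t))\<close> has the normal
  \<open>(sin (2 (\<theta> - t)), sin (2 t))\<close>, and for this choice of coefficients \<open>h\<close> cancels: the functional is
  \<open>\<Lambda> a + (\<Lambda> - sin (2 \<theta>)) b\<close> with \<open>\<Lambda> = 2 sin \<theta> cos t cos (\<theta> - t)\<close>. The restriction of \<open>t\<close> to
  \<open>[0, \<pi>/2]\<close> makes \<open>\<Lambda>\<close> nonnegative, so that \<open>a + b \<le> 1\<close> gives the bound. The other three parts
  describe the case of equality.\<close>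

lemma density_great_circle_support:
  fixes e :: "nat \<Rightarrow> 'a::complex_hilbert" and v z :: 'a
  assumes e: "orthonormal_basis e" and Y: "Y \<in> density_ops e S"
    and vz: "norm v = 1" "norm z = 1" "cinner z v = 0"
    and \<theta>: "0 < \<theta>" "\<theta> < pi / 2" and t: "0 \<le> t" "t \<le> pi / 2"
  defines "Q \<equiv> \<lambda>s. Re (cinner (Y (great_circle v z s)) (great_circle v z s))"
  shows "sin (2 * (\<theta> - t)) * Q 0 + sin (2 * t) * Q \<theta> + sin (2 * \<theta>) * Q (t + pi / 2)
      \<le> 2 * sin \<theta> * cos t * cos (\<theta> - t)"
    and "Q (t + pi / 2) = 0 \<Longrightarrow> Q \<theta> = (cos (\<theta> - t))\<^sup>2 * Q t"
    and "Q t \<le> 1" and "0 \<le> Q (t + pi / 2)"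
proof -
  have pos: "positive_op Y" using Y by (auto simp: density_ops_def)
  interpret q: positive_form "\<lambda>x y. cinner (Y x) y"
    by (rule positive_form_of_positive_op[OF pos])
  define a where "a = Q t"
  define b where "b = Q (t + pi / 2)"
  define h where "h = Re (cinner (Y (great_circle v z t)) (great_circle v z (t + pi / 2)))"
  have ab: "a + b \<le> 1" "0 \<le> a" "0 \<le> b"
    using density_great_circle_le_1[OF e Y vz, of t] by (simp_all add: a_def b_def Q_def q.nonneg)
  then show "Q t \<le> 1" "0 \<le> Q (t + pi / 2)" by (simp_all add: a_def b_def)
  have Q: "Q s = (cos (s - t))\<^sup>2 * a + 2 * sin (s - t) * cos (s - t) * h + (sin (s - t))\<^sup>2 * b" for s
    unfolding Q_def
    by (subst (1 2) great_circle_rotate[of v z s t])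
      (simp only: q.diag_add,
        simp add: q.scaleR_left q.scaleR_right a_def b_def h_def Q_def power2_eq_square)
  show "Q \<theta> = (cos (\<theta> - t))\<^sup>2 * Q t" if "Q (t + pi / 2) = 0"
  proof -
    have "h = 0"
      using q.eq_0_if_diag_eq_0[of "great_circle v z (t + pi / 2)" "great_circle v z t"] that by (simp add: h_def Q_def)
    then show ?thesis using Q[of \<theta>] that by (simp add: b_def a_def)
  qed
  define \<delta> where "\<delta> = \<theta> - t"
  have \<theta>_eq: "\<theta> = t + \<delta>" by (simp add: \<delta>_def)
  have \<theta>pos: "0 < sin \<theta>" "0 \<le> cos t" "0 \<le> cos \<delta>"
    using \<theta> t by (auto simp: \<delta>_def intro!: sin_gt_zero cos_ge_zero)
  have Q0: "Q 0 = (cos t)\<^sup>2 * a - 2 * sin t * cos t * h + (sin t)\<^sup>2 * b"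
    using Q[of 0] by simp
  have Q\<theta>: "Q \<theta> = (cos \<delta>)\<^sup>2 * a + 2 * sin \<delta> * cos \<delta> * h + (sin \<delta>)\<^sup>2 * b"
    using Q[of \<theta>] by (simp add: \<delta>_def)
  have sin\<theta>: "sin \<theta> = sin t * cos \<delta> + cos t * sin \<delta>" and cos\<theta>: "cos \<theta> = cos t * cos \<delta> - sin t * sin \<delta>"
    by (simp_all add: \<theta>_eq sin_add cos_add)
  have "sin (2 * \<delta>) * Q 0 + sin (2 * t) * Q \<theta> + sin (2 * \<theta>) * b
      = 2 * sin \<theta> * cos t * cos \<delta> * (a + b)"
    unfolding sin_double Q0 Q\<theta> cos\<theta> unfolding sin\<theta> by algebra
  also have "\<dots> \<le> 2 * sin \<theta> * cos t * cos \<delta> * 1"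
    using ab \<theta>pos by (intro mult_left_mono) auto
  finally show "sin (2 * (\<theta> - t)) * Q 0 + sin (2 * t) * Q \<theta> + sin (2 * \<theta>) * Q (t + pi / 2)
      \<le> 2 * sin \<theta> * cos t * cos (\<theta> - t)"
    by (simp add: \<delta>_def b_def)
qed

text \<open>Averaging the support inequalities of the two densities forces their expectations at \<open>t + \<pi>/2\<close>
  to vanish, because \<open>sin (2 \<theta>) > 0\<close>. Each plane point is then a multiple, by the expectation at \<open>t\<close>,
  of the given one. These factors are at most \<open>1\<close> and average to \<open>1\<close>. At \<open>t = \<pi>/2\<close>, where \<open>\<Lambda> = 0\<close> and the supporting
  line may meet the projected moment set in a whole segment, this last argument is
  what still isolates the end point.\<close>

theorem density_great_circle_rigid:
  fixes e :: "nat \<Rightarrow> 'a::complex_hilbert" and v z :: 'a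
  assumes e: "orthonormal_basis e" and Y: "Y\<^sub>1 \<in> density_ops e S" "Y\<^sub>2 \<in> density_ops e S"
    and vz: "norm v = 1" "norm z = 1" "cinner z v = 0"
    and \<theta>: "0 < \<theta>" "\<theta> < pi / 2" and t: "0 \<le> t" "t \<le> pi / 2"
    and \<tau>: "0 < \<tau>" "\<tau> < 1"
  defines "Q \<equiv> \<lambda>Y s. Re (cinner (Y (great_circle v z s)) (great_circle v z s))"
  assumes avg0: "(1 - \<tau>) * Q Y\<^sub>1 0 + \<tau> * Q Y\<^sub>2 0 = (cos t)\<^sup>2"
    and avg\<theta>: "(1 - \<tau>) * Q Y\<^sub>1 \<theta> + \<tau> * Q Y\<^sub>2 \<theta> = (cos (\<theta> - t))\<^sup>2"
  shows "Q Y\<^sub>1 t = 1" "Q Y\<^sub>2 t = 1"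
proof -
  note supp = density_great_circle_support[OF e _ vz \<theta> t]
  define \<Lambda> where "\<Lambda> = 2 * sin \<theta> * cos t * cos (\<theta> - t)"
  define l where "l = sin (2 * (\<theta> - t))"
  define m where "m = sin (2 * t)"
  define c where "c = sin (2 * \<theta>)"
  define b\<^sub>1 where "b\<^sub>1 = Q Y\<^sub>1 (t + pi / 2)"
  define b\<^sub>2 where "b\<^sub>2 = Q Y\<^sub>2 (t + pi / 2)"
  have c: "c > 0" unfolding c_def using \<theta> by (intro sin_gt_zero) auto
  have b: "0 \<le> b\<^sub>1" "0 \<le> b\<^sub>2" using supp(4)[OF Y(1)] supp(4)[OF Y(2)] by (simp_all only: b\<^sub>1_def b\<^sub>2_def Q_def)
  have le: "l * Q Y\<^sub>1 0 + m * Q Y\<^sub>1 \<theta> + c * b\<^sub>1 \<le> \<Lambda>" "l * Q Y\<^sub>2 0 + m * Q Y\<^sub>2 \<theta> + c * b\<^sub>2 \<le> \<Lambda>"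
    using supp(1)[OF Y(1)] supp(1)[OF Y(2)] by (simp_all only: l_def m_def c_def \<Lambda>_def b\<^sub>1_def b\<^sub>2_def Q_def)
  have "\<Lambda> = l * (cos t)\<^sup>2 + m * (cos (\<theta> - t))\<^sup>2"
  proof -
    have "sin \<theta> = sin (t + (\<theta> - t))" by simp
    then have "sin \<theta> = sin t * cos (\<theta> - t) + cos t * sin (\<theta> - t)" unfolding sin_add .
    then show ?thesis
      unfolding \<Lambda>_def l_def m_def sin_double by algebra
  qed
  also have "\<dots> = (1 - \<tau>) * (l * Q Y\<^sub>1 0 + m * Q Y\<^sub>1 \<theta>) + \<tau> * (l * Q Y\<^sub>2 0 + m * Q Y\<^sub>2 \<theta>)"
    unfolding avg0[symmetric] avg\<theta>[symmetric] by (simp add: algebra_simps)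
  also have "\<dots> \<le> (1 - \<tau>) * (\<Lambda> - c * b\<^sub>1) + \<tau> * (\<Lambda> - c * b\<^sub>2)"
    using \<tau> le by (intro add_mono mult_left_mono) auto
  finally have "(1 - \<tau>) * (c * b\<^sub>1) + \<tau> * (c * b\<^sub>2) \<le> 0" by (simp add: algebra_simps)
  moreover have "0 \<le> (1 - \<tau>) * (c * b\<^sub>1)" "0 \<le> \<tau> * (c * b\<^sub>2)" using \<tau> b c by simp_all
  ultimately have "(1 - \<tau>) * (c * b\<^sub>1) = 0" "\<tau> * (c * b\<^sub>2) = 0" by linarith+
  then have "b\<^sub>1 = 0" "b\<^sub>2 = 0" using \<tau> c by simp_all
  then have "Q Y\<^sub>1 \<theta> = (cos (\<theta> - t))\<^sup>2 * Q Y\<^sub>1 t" "Q Y\<^sub>2 \<theta> = (cos (\<theta> - t))\<^sup>2 * Q Y\<^sub>2 t"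
    using supp(2)[OF Y(1)] supp(2)[OF Y(2)] by (simp_all only: b\<^sub>1_def b\<^sub>2_def Q_def)
  with avg\<theta> have "(cos (\<theta> - t))\<^sup>2 * ((1 - \<tau>) * Q Y\<^sub>1 t + \<tau> * Q Y\<^sub>2 t) = (cos (\<theta> - t))\<^sup>2"
    by (simp add: algebra_simps)
  moreover have "cos (\<theta> - t) > 0" using \<theta> t by (intro cos_gt_zero_pi) auto
  ultimately have "(1 - \<tau>) * Q Y\<^sub>1 t + \<tau> * Q Y\<^sub>2 t = 1"
    by (metis less_irrefl mult_cancel_left1 zero_less_power)
  then have "(1 - \<tau>) * (1 - Q Y\<^sub>1 t) + \<tau> * (1 - Q Y\<^sub>2 t) = 0" by (simp add: algebra_simps)
  moreover have "0 \<le> (1 - \<tau>) * (1 - Q Y\<^sub>1 t)" "0 \<le> \<tau> * (1 - Q Y\<^sub>2 t)" using \<tau> supp(3)[OF Y(1)] supp(3)[OF Y(2)] by (simp_all add: Q_def)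
  ultimately have "(1 - \<tau>) * (1 - Q Y\<^sub>1 t) = 0" "\<tau> * (1 - Q Y\<^sub>2 t) = 0" by linarith+
  then show "Q Y\<^sub>1 t = 1" "Q Y\<^sub>2 t = 1" using \<tau> by simp_all
qed

section \<open>Principal standard vectors on a great circle\<close>

lemma generic_proj_nonzero:
  assumes "closed_csubspace S" "generic e S"
  shows "proj S (e j) \<noteq> 0"
proof
  obtain x where x: "x \<in> S" "cinner x (e j) \<noteq> 0" using assms(2) by (auto simp: generic_def)
  assume "proj S (e j) = 0"
  with x coordinate_eq_cinner_principal_vec[OF assms(1) x(1), of e j] show False by simp
qed

lemma norm_principal_vec:
  assumes "closed_csubspace S" "generic e S"
  shows "norm (principal_vec e S j) = 1"
  using generic_proj_nonzero[OF assms] by (simp add: principal_vec_def)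

lemma independent_imp_not_multiple:
  assumes "\<not> cdependent {v, u}" "v \<noteq> u"
  shows "u \<noteq> c *\<^sub>C v"
proof
  assume u: "u = c *\<^sub>C v"
  have "u \<in> cspan ({v, u} - {u})"
    unfolding u using assms(2) u complex_vector.span_scale[OF complex_vector.span_base[of v]] by auto
  with assms(1) show False unfolding complex_vector.dependent_def by blast
qed

lemma exp_Arg_mult_cnj: "exp (\<i> * complex_of_real (Arg x)) * cnj x = complex_of_real (cmod x)"
proof (cases "x = 0")
  case False
  define p where "p = exp (\<i> * complex_of_real (Arg x))"
  have "p * cnj p = 1" by (simp add: p_def exp_cnj flip: exp_add)
  moreover have "cnj x = complex_of_real (cmod x) * cnj p"
    using arg_cong[OF Arg_eq[OF False], of cnj] by (simp add: p_def)
  ultimately show ?thesis unfolding p_def[symmetric] by (simp add: mult.left_commute)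
qed simp

text \<open>Splitting \<open>u = c v + w\<close> with \<open>w \<bottom> v\<close> gives \<open>\<phi> u = (\<phi> c) v + \<parallel>w\<parallel> z\<close> for \<open>z = \<phi> w / \<parallel>w\<parallel>\<close>. The argument
  of the \<open>k\<close>-th coordinate of \<open>v\<close> is minus that of \<open>c\<close>, hence \<open>\<phi> c = \<bar>c\<bar> = cos \<theta>\<close> and
  \<open>\<parallel>w\<parallel> = sin \<theta>\<close>. If \<open>c = 0\<close>, then \<open>\<phi> = 1\<close> and
  \<open>\<theta> = \<pi>/2\<close>.\<close>

lemma curve_vec_eq_great_circle:
  assumes S: "closed_csubspace S" and gen: "generic e S"
    and "principal_vec e S j \<noteq> principal_vec e S k"
    and "\<not> cdependent {principal_vec e S j, principal_vec e S k}"
  obtains z \<phi> \<theta> where "z \<in> S" "norm z = 1" "cinner z (principal_vec e S j) = 0"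
    "0 < \<theta>" "\<theta> \<le> pi / 2" "cos \<theta> = cmod (cinner (principal_vec e S j) (principal_vec e S k))"
    "cmod \<phi> = 1" "\<phi> *\<^sub>C principal_vec e S k = great_circle (principal_vec e S j) z \<theta>"
    "\<And>t. curve_vec e S j k t = great_circle (principal_vec e S j) z t"
proof -
  define v where "v = principal_vec e S j"
  define u where "u = principal_vec e S k"
  define c where "c = cinner u v"
  define w where "w = u - c *\<^sub>C v"
  define \<phi> where "\<phi> = exp (\<i> * complex_of_real (Arg (cinner v (e k))))"
  define z where "z = \<phi> *\<^sub>C (w /\<^sub>R norm w)"
  have v: "norm v = 1" "v \<in> S" and u: "norm u = 1" "u \<in> S"
    by (simp_all add: v_def u_def norm_principal_vec[OF S gen] principal_vec_in[OF S])
  have vv: "cinner v v = 1" "cinner u u = 1" using v u by (simp_all add: cinner_self)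
  have w: "w \<noteq> 0"
    using independent_imp_not_multiple[of v u c] assms(3,4) by (auto simp: w_def v_def u_def)
  have \<phi>: "cmod \<phi> = 1" by (simp add: \<phi>_def)
  have \<phi>c: "\<phi> * c = complex_of_real (cmod c)"
  proof -
    have vk: "cinner v (e k) = complex_of_real (norm (proj S (e k))) * cnj c"
      using coordinate_eq_cinner_principal_vec[OF S v(2), of e k] cinner_commute[of v u]
      by (simp add: u_def c_def)
    have B: "norm (proj S (e k)) > 0" using generic_proj_nonzero[OF S gen] by simp
    have "complex_of_real (norm (proj S (e k))) * (\<phi> * c)
        = complex_of_real (norm (proj S (e k))) * complex_of_real (cmod c)"
    proof -
      have "\<phi> * cnj (cinner v (e k)) = complex_of_real (cmod (cinner v (e k)))"
        unfolding \<phi>_def by (rule exp_Arg_mult_cnj)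
      then show ?thesis unfolding vk by (simp add: norm_mult mult_ac)
    qed
    then show ?thesis using B by simp
  qed
  have nw: "(norm w)\<^sup>2 = 1 - (cmod c)\<^sup>2"
    using cinner.diag_diff_component[of u 1 v] vv
    by (simp add: norm_power2_eq_cinner w_def c_def)
  have c1: "cmod c < 1"
    using nw w abs_square_less_1[of "cmod c"] by (metis abs_norm_cancel diff_gt_0_iff_gt zero_less_norm_iff zero_less_power)
  define \<theta> where "\<theta> = arccos (cmod c)"
  have cos\<theta>: "cos \<theta> = cmod c" using c1 by (simp add: \<theta>_def cos_arccos_abs)
  have \<theta>: "0 < \<theta>" "\<theta> \<le> pi / 2"
    using c1 arccos_le_pi2[of "cmod c"] arccos_less_arccos[of "cmod c" 1] norm_ge_zero[of c]
    unfolding \<theta>_def by (simp_all del: norm_ge_zero)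
  have sin\<theta>: "sin \<theta> = norm w"
  proof (rule power2_eq_imp_eq)
    show "(sin \<theta>)\<^sup>2 = (norm w)\<^sup>2" by (simp add: sin_squared_eq cos\<theta> nw)
    show "0 \<le> sin \<theta>" using \<theta> by (intro sin_ge_zero) auto
  qed simp
  show ?thesis
  proof (rule that[folded v_def u_def])
    show "z \<in> S" unfolding z_def w_def by (intro closed_csubspaceD[OF S] u v)
    show "norm z = 1" using w by (simp add: z_def norm_scaleC \<phi>)
    have "cinner w v = 0" by (simp add: w_def cinner.diff_left cinner_scaleC_left vv c_def)
    then show "cinner z v = 0" by (simp add: z_def cinner_scaleC_left cinner.scaleR_left)
    show "cos \<theta> = cmod (cinner v u)"
      using cinner_commute[of v u] by (simp add: cos\<theta> c_def)
    have "u = c *\<^sub>C v + norm w *\<^sub>R (w /\<^sub>R norm w)" using w by (simp add: w_def)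
    then have "\<phi> *\<^sub>C u = (\<phi> * c) *\<^sub>C v + \<phi> *\<^sub>C complex_of_real (norm w) *\<^sub>C (w /\<^sub>R norm w)"
      unfolding scaleC_of_real by (metis scaleC_add_right scaleC_scaleC)
    then show "\<phi> *\<^sub>C u = great_circle v z \<theta>"
      unfolding great_circle_def cos\<theta> sin\<theta> z_def scaleC_of_real[symmetric] \<phi>c by (simp only: scaleC_scaleC mult_ac)
    show "curve_vec e S j k t = great_circle v z t" for t
      unfolding great_circle_def curve_vec_def Let_def v_def[symmetric] u_def[symmetric] c_def[symmetric]
        w_def[symmetric] \<phi>_def[symmetric] z_def
      by (simp add: scaleC_scaleC flip: scaleC_of_real)
  qed (use \<theta> \<phi> in auto)
qed

section \<open>Planar geometry\<close>

text \<open>The quadratic form comes from the identity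
  \<open>cos\<^sup>2 t - 2 cos \<theta> cos t cos (t - \<theta>) + cos\<^sup>2 (t - \<theta>) = sin\<^sup>2 \<theta>\<close>, the law of cosines for the angles
  \<open>t\<close> and \<open>t - \<theta>\<close>.\<close>

lemma cos_cos_in_centered_ellipse:
  fixes A B \<theta> :: real
  assumes "A > 0" "B > 0" "sin \<theta> > 0"
  obtains C where "centered_ellipse C" "\<And>t. (A * cos t, B * cos (t - \<theta>)) \<in> C"
proof -
  define s where "s = sin \<theta>"
  define C where "C = {(x, y). 1 / (A * s)\<^sup>2 * x\<^sup>2 + (- 2 * cos \<theta> / (A * B * s\<^sup>2)) * x * y + 1 / (B * s)\<^sup>2 * y\<^sup>2 = 1}"
  have s: "s > 0" using assms by (simp add: s_def)
  have "(cos \<theta>)\<^sup>2 < 1" using s sin_cos_squared_add[of \<theta>] unfolding s_def[symmetric]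
    by (metis less_add_same_cancel2 zero_less_power)
  then have "(- 2 * cos \<theta> / (A * B * s\<^sup>2))\<^sup>2 < 4 * (1 / (A * s)\<^sup>2) * (1 / (B * s)\<^sup>2)"
    using assms s by (simp add: field_simps power2_eq_square)
  moreover have "0 < 1 / (A * s)\<^sup>2" using assms s by simp
  ultimately have "centered_ellipse C"
    unfolding centered_ellipse_def C_def by blast
  moreover have "(A * cos t, B * cos (t - \<theta>)) \<in> C" for t
  proof -
    define d where "d = t - \<theta>"
    have \<theta>: "\<theta> = t - d" by (simp add: d_def)
    have "(cos t)\<^sup>2 - 2 * cos \<theta> * cos t * cos d + (cos d)\<^sup>2 = s\<^sup>2"
      using sin_cos_squared_add[of t] sin_cos_squared_add[of d]
      unfolding s_def \<theta> cos_diff sin_diff by algebra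
    then have "((cos t)\<^sup>2 - 2 * cos \<theta> * cos t * cos d + (cos d)\<^sup>2) / s\<^sup>2 = 1" using s by simp
    then show ?thesis
      using assms s by (simp add: C_def d_def[symmetric] power_mult_distrib divide_simps) algebra
  qed
  ultimately show ?thesis by (rule that)
qed

lemma cos2_sin2_image_eq_segment:
  fixes P Q :: real
  shows "(\<lambda>t. (P * (cos t)\<^sup>2, Q * (sin t)\<^sup>2)) ` {0..pi/2} = closed_segment (P, 0) (0, Q)"
proof -
  have eq: "(P * (cos t)\<^sup>2, Q * (sin t)\<^sup>2) = (1 - (sin t)\<^sup>2) *\<^sub>R (P, 0) + (sin t)\<^sup>2 *\<^sub>R (0, Q)" for t
    by (simp add: cos_squared_eq mult.commute)
  show ?thesis
  proof (intro subset_antisym subsetI)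
    fix p assume "p \<in> (\<lambda>t. (P * (cos t)\<^sup>2, Q * (sin t)\<^sup>2)) ` {0..pi/2}"
    then obtain t where "p = (P * (cos t)\<^sup>2, Q * (sin t)\<^sup>2)" by blast
    moreover have "(sin t)\<^sup>2 \<le> 1" by (simp add: abs_square_le_1)
    ultimately show "p \<in> closed_segment (P, 0) (0, Q)"
      unfolding closed_segment_def eq by force
  next
    fix p assume "p \<in> closed_segment (P, 0) (0, Q)"
    then obtain r where r: "0 \<le> r" "r \<le> 1" "p = (1 - r) *\<^sub>R (P, 0) + r *\<^sub>R (0, Q)"
      by (auto simp: closed_segment_def)
    have "0 \<le> sqrt r" "sqrt r \<le> 1" using r by simp_all
    moreover from this have "- 1 \<le> sqrt r" by linarith
    ultimately have "(sin (arcsin (sqrt r)))\<^sup>2 = r" "arcsin (sqrt r) \<in> {0..pi/2}"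
      using r arcsin_bounded[of "sqrt r"] arcsin_le_arcsin[of 0 "sqrt r"] by simp_all
    moreover from this(1) have "p = (P * (cos (arcsin (sqrt r)))\<^sup>2, Q * (sin (arcsin (sqrt r)))\<^sup>2)"
      using r(3) unfolding eq by (simp only:)
    ultimately show "p \<in> (\<lambda>t. (P * (cos t)\<^sup>2, Q * (sin t)\<^sup>2)) ` {0..pi/2}"
      by blast
  qed
qed

lemma frontier_of_halfplane_bound:
  fixes X :: "(real \<times> real) set"
  assumes "\<And>x y. (x, y) \<in> X \<Longrightarrow> \<alpha> * x + \<beta> * y \<le> 1"
    and "\<alpha> > 0" and "(x, y) \<in> X" and "\<alpha> * x + \<beta> * y = 1"
  shows "(x, y) \<in> frontier X"
proof -
  have "(x, y) \<notin> interior X"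
  proof
    assume "(x, y) \<in> interior X"
    then obtain r where r: "r > 0" "ball (x, y) r \<subseteq> X" by (auto simp: mem_interior)
    have "(x + r / 2, y) \<in> ball (x, y) r"
      using r by (simp add: dist_Pair_Pair dist_real_def)
    then have "\<alpha> * (x + r / 2) + \<beta> * y \<le> 1" using r assms(1) by blast
    moreover have "\<alpha> * (r / 2) > 0" using r assms(2) by simp
    ultimately show False using assms(4) by (simp add: ring_distribs)
  qed
  then show ?thesis using assms(3) closure_subset by (auto simp: frontier_def)
qed

section \<open>Ellipse, boundary segment and extreme points\<close>

theorem theorem2:
  fixes e :: "nat \<Rightarrow> 'a::complex_hilbert" and S :: "'a set" and j k :: nat
  assumes "orthonormal_basis e"
    and "closed_csubspace S"
    and "generic e S"
    and "principal_vec e S j \<noteq> principal_vec e S k"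
    and "\<not> cdependent {principal_vec e S j, principal_vec e S k}"
  shows
    "moment_curve e S j k ` {0..pi/2} \<subseteq> moment_set e S \<and>
     (\<exists>C. centered_ellipse C \<and>
        (\<lambda>t. (cmod (curve_coord e S j k j t), cmod (curve_coord e S j k k t))) ` {0..pi/2} \<subseteq> C) \<and>
     (cinner (principal_vec e S j) (principal_vec e S k) = 0 \<longrightarrow>
        (\<exists>p q. p \<noteq> q \<and>
           (\<lambda>t. ((cmod (curve_coord e S j k j t))\<^sup>2, (cmod (curve_coord e S j k k t))\<^sup>2)) ` {0..pi/2}
             = closed_segment p q \<and>
           closed_segment p q \<subseteq> frontier ((\<lambda>x. (x j, x k)) ` moment_set e S))) \<and>
     (cinner (principal_vec e S j) (principal_vec e S k) \<noteq> 0 \<longrightarrow>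
        (\<forall>t\<in>{0..pi/2}.
           ((cmod (curve_coord e S j k j t))\<^sup>2, (cmod (curve_coord e S j k k t))\<^sup>2)
             extreme_point_of ((\<lambda>x. (x j, x k)) ` moment_set e S) \<and>
           moment_curve e S j k t extreme_point_of moment_set e S))"
proof -
  note e = assms(1) and S = assms(2) and gen = assms(3)
  define v where "v = principal_vec e S j"
  define u where "u = principal_vec e S k"
  define A where "A = norm (proj S (e j))"
  define B where "B = norm (proj S (e k))"
  obtain z \<phi> \<theta> where z: "z \<in> S" "norm z = 1" "cinner z v = 0"
    and \<theta>: "0 < \<theta>" "\<theta> \<le> pi / 2" and cos\<theta>: "cos \<theta> = cmod (cinner v u)"
    and \<phi>: "cmod \<phi> = 1" "\<phi> *\<^sub>C u = great_circle v z \<theta>"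
    and curve: "\<And>t. curve_vec e S j k t = great_circle v z t"
    unfolding v_def u_def by (rule curve_vec_eq_great_circle[OF assms(2-5)]) blast
  have v: "norm v = 1" "v \<in> S" and AB: "A > 0" "B > 0"
    by (simp_all add: v_def A_def B_def norm_principal_vec[OF S gen] principal_vec_in[OF S]
        generic_proj_nonzero[OF S gen])
  note vz = v(1) z(2,3)
  have arc: "great_circle v z t \<in> S" "norm (great_circle v z t) = 1" for t
    using great_circle_in[OF S v(2) z(1)] norm_great_circle[OF vz] by blast+
  have coord_j: "cmod (curve_coord e S j k j t) = A * \<bar>cos t\<bar>" for t
    using coordinate_eq_cinner_principal_vec[OF S arc(1), of t e j] cinner_great_circle[OF vz, of t 0] AB
    by (simp add: curve_coord_def curve great_circle_0 A_def norm_mult flip: v_def)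
  have coord_k: "cmod (curve_coord e S j k k t) = B * \<bar>cos (t - \<theta>)\<bar>" for t
  proof -
    have "cmod (cinner (great_circle v z t) u) = cmod (cinner (great_circle v z t) (\<phi> *\<^sub>C u))"
      by (simp add: cinner.scaleC_right norm_mult \<phi>(1))
    also have "\<dots> = \<bar>cos (t - \<theta>)\<bar>"
      by (simp add: \<phi>(2) cinner_great_circle[OF vz])
    finally show ?thesis
      using coordinate_eq_cinner_principal_vec[OF S arc(1), of t e k] AB
      by (simp add: curve_coord_def curve B_def norm_mult flip: u_def)
  qed
  have curve_in: "moment_curve e S j k t \<in> moment_set e S" for t
    using rank_one_moment[OF e S arc, of t] by (simp add: moment_curve_def curve_coord_def curve)
  define Q where "Q = (\<lambda>Y s. Re (cinner (Y (great_circle v z s)) (great_circle v z s)))"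
  define diag where "diag = (\<lambda>Y n. Re (cinner (Y (e n)) (e n)))"
  have moment_set: "moment_set e S = diag ` density_ops e S"
    by (simp add: moment_set_def diag_def)
  have diag_j: "diag Y j = A\<^sup>2 * Q Y 0" if "Y \<in> density_ops e S" for Y
    using density_diagonal[OF S that, of j] by (simp add: diag_def A_def Q_def great_circle_0 v_def)
  have diag_k: "diag Y k = B\<^sup>2 * Q Y \<theta>" if Y: "Y \<in> density_ops e S" for Y
  proof -
    interpret q: positive_form "\<lambda>x y. cinner (Y x) y"
      using Y by (intro positive_form_of_positive_op) (simp add: density_ops_def)
    show ?thesis
      using density_diagonal[OF S Y, of k] q.diag_scaleC[of \<phi> u] \<phi>
      by (simp add: diag_def B_def Q_def u_def)
  qed

  have ellipse: "\<exists>C. centered_ellipse C \<and>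
        (\<lambda>t. (cmod (curve_coord e S j k j t), cmod (curve_coord e S j k k t))) ` {0..pi/2} \<subseteq> C"
  proof -
    have "sin \<theta> > 0" using \<theta> by (intro sin_gt_zero) auto
    then obtain C where C: "centered_ellipse C" "\<And>t. (A * cos t, B * cos (t - \<theta>)) \<in> C"
      using cos_cos_in_centered_ellipse[OF AB] by blast
    have "(cmod (curve_coord e S j k j t), cmod (curve_coord e S j k k t)) \<in> C"
      if "t \<in> {0..pi/2}" for t
    proof -
      have "cos t \<ge> 0" "cos (t - \<theta>) \<ge> 0" using that \<theta> by (auto intro!: cos_ge_zero)
      then show ?thesis using C(2)[of t] by (simp add: coord_j coord_k)
    qed
    with C(1) show ?thesis by blast
  qed

  have segment: "\<exists>p q. p \<noteq> q \<and>
           (\<lambda>t. ((cmod (curve_coord e S j k j t))\<^sup>2, (cmod (curve_coord e S j k k t))\<^sup>2)) ` {0..pi/2}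
             = closed_segment p q \<and>
           closed_segment p q \<subseteq> frontier ((\<lambda>x. (x j, x k)) ` moment_set e S)"
    if "cinner v u = 0"
  proof (intro exI conjI)
    have \<theta>_eq: "\<theta> = pi / 2"
      using cos\<theta> that \<theta> cos_gt_zero[of \<theta>] by (cases "\<theta> = pi / 2") auto
    show "(A\<^sup>2, 0) \<noteq> (0, B\<^sup>2)" using AB by simp
    have pt: "((cmod (curve_coord e S j k j t))\<^sup>2, (cmod (curve_coord e S j k k t))\<^sup>2)
        = (A\<^sup>2 * (cos t)\<^sup>2, B\<^sup>2 * (sin t)\<^sup>2)" for t
      by (simp add: coord_j coord_k \<theta>_eq cos_diff power_mult_distrib)
    show img: "(\<lambda>t. ((cmod (curve_coord e S j k j t))\<^sup>2, (cmod (curve_coord e S j k k t))\<^sup>2)) ` {0..pi/2}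
             = closed_segment (A\<^sup>2, 0) (0, B\<^sup>2)"
      unfolding pt by (rule cos2_sin2_image_eq_segment)
    show "closed_segment (A\<^sup>2, 0) (0, B\<^sup>2) \<subseteq> frontier ((\<lambda>x. (x j, x k)) ` moment_set e S)"
      unfolding img[symmetric]
    proof (rule image_subsetI)
      fix t
      let ?X = "(\<lambda>x. (x j, x k)) ` moment_set e S"
      show "((cmod (curve_coord e S j k j t))\<^sup>2, (cmod (curve_coord e S j k k t))\<^sup>2) \<in> frontier ?X"
      proof (rule frontier_of_halfplane_bound[of _ "1 / A\<^sup>2" "1 / B\<^sup>2"])
        fix x y assume "(x, y) \<in> ?X"
        then obtain Y where Y: "Y \<in> density_ops e S" "x = diag Y j" "y = diag Y k"
          unfolding moment_set by auto
        have "Q Y 0 + Q Y (pi / 2) \<le> 1"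
          using density_great_circle_le_1[OF e Y(1) vz, of 0] by (simp add: Q_def)
        then show "1 / A\<^sup>2 * x + 1 / B\<^sup>2 * y \<le> 1"
          using AB by (simp add: Y diag_j diag_k \<theta>_eq)
      next
        show "((cmod (curve_coord e S j k j t))\<^sup>2, (cmod (curve_coord e S j k k t))\<^sup>2) \<in> ?X"
          using curve_in[of t] by (auto simp: moment_curve_def intro!: image_eqI)
        show "1 / A\<^sup>2 * (cmod (curve_coord e S j k j t))\<^sup>2 + 1 / B\<^sup>2 * (cmod (curve_coord e S j k k t))\<^sup>2 = 1"
          using pt[of t] AB by simp
      qed (use AB in simp)
    qed
  qed

  have extreme: "((cmod (curve_coord e S j k j t))\<^sup>2, (cmod (curve_coord e S j k k t))\<^sup>2)
             extreme_point_of ((\<lambda>x. (x j, x k)) ` moment_set e S) \<and>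
           moment_curve e S j k t extreme_point_of moment_set e S"
    if nz: "cinner v u \<noteq> 0" and t: "t \<in> {0..pi/2}" for t
  proof -
    have \<theta>': "\<theta> < pi / 2" using \<theta> cos\<theta> nz by (cases "\<theta> = pi / 2") auto
    have t': "0 \<le> t" "t \<le> pi / 2" using t by simp_all
    define \<gamma> where "\<gamma> = moment_curve e S j k t"
    have \<gamma>j: "\<gamma> j = (cmod (curve_coord e S j k j t))\<^sup>2" and \<gamma>k: "\<gamma> k = (cmod (curve_coord e S j k k t))\<^sup>2"
      by (simp_all add: \<gamma>_def moment_curve_def)
    (* Only the coordinates j and k of the combination enter, so this covers both the plane
       projection and the sequence space. *)
    have rigid: "x = \<gamma> \<and> y = \<gamma>"
      if x: "x \<in> moment_set e S" and y: "y \<in> moment_set e S" and \<tau>: "0 < \<tau>" "\<tau> < 1"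
        and j: "\<gamma> j = (1 - \<tau>) * x j + \<tau> * y j" and k: "\<gamma> k = (1 - \<tau>) * x k + \<tau> * y k"
      for x y \<tau>
    proof -
      obtain Y\<^sub>1 Y\<^sub>2 where Y: "Y\<^sub>1 \<in> density_ops e S" "Y\<^sub>2 \<in> density_ops e S"
        and xy: "x = diag Y\<^sub>1" "y = diag Y\<^sub>2"
        using x y unfolding moment_set by blast
      have "A\<^sup>2 * ((1 - \<tau>) * Q Y\<^sub>1 0 + \<tau> * Q Y\<^sub>2 0) = A\<^sup>2 * (cos t)\<^sup>2"
        using j by (simp add: \<gamma>j coord_j xy diag_j Y power_mult_distrib algebra_simps)
      then have 0: "(1 - \<tau>) * Q Y\<^sub>1 0 + \<tau> * Q Y\<^sub>2 0 = (cos t)\<^sup>2" using AB by simp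
      have "B\<^sup>2 * ((1 - \<tau>) * Q Y\<^sub>1 \<theta> + \<tau> * Q Y\<^sub>2 \<theta>) = B\<^sup>2 * (cos (t - \<theta>))\<^sup>2"
        using k by (simp add: \<gamma>k coord_k xy diag_k Y power_mult_distrib algebra_simps)
      then have 1: "(1 - \<tau>) * Q Y\<^sub>1 \<theta> + \<tau> * Q Y\<^sub>2 \<theta> = (cos (\<theta> - t))\<^sup>2"
        using AB cos_minus[of "t - \<theta>"] by simp
      have "Q Y\<^sub>1 t = 1" "Q Y\<^sub>2 t = 1"
        using density_great_circle_rigid[OF e Y vz \<theta>(1) \<theta>' t' \<tau> 0[unfolded Q_def] 1[unfolded Q_def]]
        by (simp_all only: Q_def)
      then have "diag Y\<^sub>1 = \<gamma>" "diag Y\<^sub>2 = \<gamma>"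
        using density_pure_diagonal[OF e Y(1) arc(2)[of t]] density_pure_diagonal[OF e Y(2) arc(2)[of t]]
        by (auto simp: diag_def \<gamma>_def Q_def moment_curve_def curve_coord_def curve)
      then show ?thesis by (simp add: xy)
    qed
    have "(\<gamma> j, \<gamma> k) extreme_point_of ((\<lambda>x. (x j, x k)) ` moment_set e S)"
      unfolding extreme_point_of_def
    proof (intro conjI ballI notI)
      show "(\<gamma> j, \<gamma> k) \<in> (\<lambda>x. (x j, x k)) ` moment_set e S"
        using curve_in[of t] by (auto simp: \<gamma>_def)
      fix p q
      assume "p \<in> (\<lambda>x. (x j, x k)) ` moment_set e S" "q \<in> (\<lambda>x. (x j, x k)) ` moment_set e S"
        and pq: "(\<gamma> j, \<gamma> k) \<in> open_segment p q"
      then obtain x y where xy: "x \<in> moment_set e S" "y \<in> moment_set e S"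
        and p: "p = (x j, x k)" and q: "q = (y j, y k)" by blast
      from pq obtain \<tau> where "p \<noteq> q" and \<tau>: "0 < \<tau>" "\<tau> < 1"
        and comb: "(\<gamma> j, \<gamma> k) = (1 - \<tau>) *\<^sub>R p + \<tau> *\<^sub>R q"
        by (auto simp: in_segment)
      have "\<gamma> j = (1 - \<tau>) * x j + \<tau> * y j" "\<gamma> k = (1 - \<tau>) * x k + \<tau> * y k"
        using comb unfolding p q by simp_all
      from rigid[OF xy \<tau> this] \<open>p \<noteq> q\<close> show False unfolding p q by blast
    qed
    moreover have "\<gamma> extreme_point_of moment_set e S"
      unfolding extreme_point_of_def
    proof (intro conjI ballI notI)
      show "\<gamma> \<in> moment_set e S" using curve_in by (simp add: \<gamma>_def)
      fix x y
      assume xy: "x \<in> moment_set e S" "y \<in> moment_set e S" and "\<gamma> \<in> open_segment x y"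
      then obtain \<tau> where "x \<noteq> y" and \<tau>: "0 < \<tau>" "\<tau> < 1" and "\<gamma> = (1 - \<tau>) *\<^sub>R x + \<tau> *\<^sub>R y"
        by (auto simp: in_segment)
      then have \<gamma>_eq: "\<gamma> n = (1 - \<tau>) * x n + \<tau> * y n" for n
        by (metis plus_fun_apply real_scaleR_def scaleR_fun_def)
      from rigid[OF xy \<tau> \<gamma>_eq \<gamma>_eq] \<open>x \<noteq> y\<close> show False by blast
    qed
    ultimately show ?thesis unfolding \<gamma>j \<gamma>k unfolding \<gamma>_def by blast
  qed

  have "moment_curve e S j k ` {0..pi/2} \<subseteq> moment_set e S" using curve_in by blast
  with ellipse segment extreme show ?thesis unfolding v_def u_def by blast
qed

end
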